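(* Let $f:\mathbb{R}^{n_x}\to\mathbb{R}^{n_x}$ and $h:\mathbb{R}^{n_x}\to\mathbb{R}^{n_y}$ be smooth and let $\mathcal{X}\subset\mathbb{R}^{n_x}$ be compact. Let $m$ be a positive integer such that the map $$H_m(x):=\big(h(x),L_fh(x),\dots,L_f^{m-1}h(x)\big)$$ is full-rank on $\mathcal{X}$ (its Jacobian matrix has full rank at every $x\in\mathcal{X}$). Let $(A_o,B_o)\in\mathbb{R}^{m\times m}\times\mathbb{R}^m$ be a controllable pair with $A_o$ Hurwitz, and define $A:=I_{n_y}\otimes A_o$, $B:=I_{n_y}\otimes B_o$, and $n_z:=m\,n_y$. Then there exists $k^\star>0$ such that, for all $k>k^\star$, there exists a $C^1$ map $T_k:\mathbb{R}^{n_x}\to\mathbb{R}^{n_z}$ which is full-rank on $\mathcal{X}$ (its Jacobian matrix has full rank at every $x\in\mathcal{X}$) and verifies $$\frac{\partial T_k}{\partial x}(x)f(x)=kA\,T_k(x)+B\,h(x)\qquad\forall x\in\mathcal{X}.$$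
   Context: $L_f^jh$ denotes the $j$-th iterated Lie derivative of (each component of) $h$ along the vector field $f$: $L_f^0h=h$ and $L_f^{j+1}h(x)=\frac{\partial L_f^jh}{\partial x}(x)f(x)$. $\otimes$ is the Kronecker product and $I_{n_y}$ the $n_y\times n_y$ identity matrix. The pair $(A_o,B_o)$ is controllable if $B_o,A_oB_o,\dots,A_o^{m-1}B_o$ span $\mathbb{R}^m$. A square matrix is Hurwitz if all its eigenvalues have negative real part. *)

theory Defs
  imports "HOL-Analysis.Analysis"
begin

text \<open>
  \<open>C\<^sup>k\<close> on the whole space, by recursion on the directional derivatives. For finite-dimensional
  domains this agrees with \<open>k\<close>-fold continuous Frechet differentiability.
\<close>
fun C_k :: "nat \<Rightarrow> ('a::real_normed_vector \<Rightarrow> 'b::real_normed_vector) \<Rightarrow> bool" where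
  "C_k 0 F \<longleftrightarrow> continuous_on UNIV F"
| "C_k (Suc k) F \<longleftrightarrow>
     (\<forall>x. F differentiable (at x)) \<and> (\<forall>v. C_k k (\<lambda>x. frechet_derivative F (at x) v))"

definition smooth :: "('a::real_normed_vector \<Rightarrow> 'b::real_normed_vector) \<Rightarrow> bool" where
  "smooth F \<longleftrightarrow> (\<forall>k. C_k k F)"

fun lie_derivative :: "(real^'n \<Rightarrow> real^'n) \<Rightarrow> nat \<Rightarrow> (real^'n \<Rightarrow> real^'p) \<Rightarrow> real^'n \<Rightarrow> real^'p" where
  "lie_derivative f 0 h = h"
| "lie_derivative f (Suc j) h = (\<lambda>x. jacobian (lie_derivative f j h) (at x) *v f x)"

text \<open>
  The stacked map \<open>(h, L\<^sub>f h, \<dots>, L\<^sub>f\<^bsup>m-1\<^esup> h)\<close> with \<open>m = CARD('m)\<close>. Its values have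
  \<open>m * CARD('p)\<close> components, indexed by \<open>'p \<times> 'm\<close>. On a finite type, \<open>to_nat_on UNIV\<close> is a
  bijection onto \<open>{..<m}\<close>, so component \<open>(i, l)\<close> runs through all the \<open>L\<^sub>f\<^sup>j h\<^sub>i\<close> with
  \<open>j < m\<close>, each occurring once; which enumeration it is only permutes the rows of the Jacobian.
\<close>
definition stacked_lie ::
  "(real^'n \<Rightarrow> real^'n) \<Rightarrow> (real^'n \<Rightarrow> real^'p) \<Rightarrow> real^'n \<Rightarrow> real^('p \<times> 'm::finite)" where
  "stacked_lie f h x = (\<chi> q. lie_derivative f (to_nat_on (UNIV :: 'm set) (snd q)) h x $ fst q)"

text \<open>Full rank means maximal rank, whichever of the two dimensions is smaller.\<close>
definition full_rank_on :: "(real^'n) set \<Rightarrow> (real^'n \<Rightarrow> real^'p) \<Rightarrow> bool" where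
  "full_rank_on X F \<longleftrightarrow> (\<forall>x\<in>X. rank (jacobian F (at x)) = min CARD('p) CARD('n))"

definition controllable :: "real^'m^'m \<Rightarrow> real^'m \<Rightarrow> bool" where
  "controllable A b \<longleftrightarrow> span ((\<lambda>j. (((*v) A) ^^ j) b) ` {..<CARD('m)}) = UNIV"

definition hurwitz :: "real^'m^'m \<Rightarrow> bool" where
  "hurwitz A \<longleftrightarrow>
     (\<forall>(c::complex) v. v \<noteq> 0 \<and> map_matrix complex_of_real A *v v = c *s v \<longrightarrow> Re c < 0)"

definition kronecker :: "real^'b^'a \<Rightarrow> real^'d^'c \<Rightarrow> real^('b \<times> 'd)^('a \<times> 'c)" where
  "kronecker M N = (\<chi> p q. M $ fst p $ fst q * N $ snd p $ snd q)"

text \<open>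
  Kronecker product with a column vector, regarded as a one-column matrix; the column index type
  \<open>'b \<times> 1\<close> is identified with \<open>'b\<close>.
\<close>
definition kronecker_vec :: "real^'b^'a \<Rightarrow> real^'c \<Rightarrow> real^'b^('a \<times> 'c)" where
  "kronecker_vec M v = (\<chi> p j. kronecker M (columnvector v :: real^1^'c) $ p $ (j, 1))"

end

theory Submission
  imports Defs "HOL-Computational_Algebra.Fundamental_Theorem_Algebra"
begin

text \<open>
  Put \<open>T = - \<Sum>\<^sub>j\<^sub><\<^sub>m (k A)\<^sup>-\<^sup>j\<^sup>-\<^sup>1 B L\<^sub>f\<^sup>j h + k\<^sup>-\<^sup>m S\<close>. The sum telescopes under \<open>L\<^sub>f - k A\<close>, so \<open>T\<close> solves the
  equation as soon as \<open>L\<^sub>f S = k A S + A\<^sup>-\<^sup>m B L\<^sub>f\<^sup>m h\<close> on \<open>X\<close>. By controllability the sum is an invertible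
  linear map, with inverse of order \<open>k\<^sup>m\<close>, applied to the jet \<open>H\<^sub>m\<close>. Hence, if the derivative of \<open>S\<close> is
  \<open>O(1/k)\<close>, the Jacobian of \<open>T\<close> is an invertible matrix times an \<open>O(1/k)\<close> perturbation of the Jacobian of
  \<open>H\<^sub>m\<close>, and full rank is an open condition.

  The function \<open>S\<close> is obtained without the flow of \<open>f\<close>. Iterating from \<open>0\<close> the map that
  sends \<open>u\<close> to \<open>x \<mapsto> e G(x) + (I + e k A) u(x - e F(x))\<close> gives approximate solutions. In a norm in which \<open>I + e k A\<close>
  contracts by \<open>1 - e k a\<close>, this map preserves, for \<open>k\<close> large, bounds on \<open>u\<close>, on its derivative and on the
  quadratic Taylor error which do not depend on \<open>e\<close>. A compactness argument as \<open>e\<close> tends to \<open>0\<close> gives \<open>S\<close>.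
\<close>

section \<open>Functions with quadratic Taylor error\<close>

text \<open>Each Euler iterate is a composition of known functions, so its derivative is explicit.
  The limit must still be C^1; therefore the derivative \<open>D\<close> travels as separate data,
  and regularity is expressed by inequalities that each involve at most two points. These survive
  pointwise limits, and the quadratic error alone forces \<open>D\<close> to be the derivative and
  to be Lipschitz. Values are measured by the adapted norm \<open>N\<close>, increments in the
  domain by the given one. The moved argument costs a factor 1 + e L per order of differentiation,
  so the decay rate k a of the linear part must exceed 2 L; this is one of the lower bounds on k.
  Such global constants are available because \<open>f\<close> and the source term are first
  modified away from \<open>X\<close> so as to have bounded, Lipschitz derivatives. The adapted norm
  rests on decay along single vectors, proved by peeling roots off an annihilating
  polynomial.\<close>

definition C11 :: "('b::real_normed_vector \<Rightarrow> real) \<Rightarrow> real \<Rightarrow> real \<Rightarrow>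
    ('a::real_normed_vector \<Rightarrow> 'b) \<Rightarrow> ('a \<Rightarrow> 'a \<Rightarrow>\<^sub>L 'b) \<Rightarrow> bool" where
  "C11 N L M u D \<longleftrightarrow> (\<forall>x w. N (D x w) \<le> L * norm w) \<and>
     (\<forall>x y. N (u y - u x - D x (y - x)) \<le> M * (norm (y - x))\<^sup>2)"

lemma quadratic_error_has_derivative:
  fixes D :: "'a::real_normed_vector \<Rightarrow>\<^sub>L 'b::real_normed_vector"
  assumes "\<And>y. norm (u y - u x - D (y - x)) \<le> M * (norm (y - x))\<^sup>2"
  shows "(u has_derivative D) (at x)"
proof -
  have "((\<lambda>y. norm (u y - u x - D (y - x)) / norm (y - x)) \<longlongrightarrow> 0) (at x)"
  proof (rule Lim_null_comparison)
    have "norm (norm (u y - u x - D (y - x)) / norm (y - x)) \<le> M * norm (y - x)" for y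
      using assms[of y]
      by (cases "y = x") (auto simp: divide_simps power2_eq_square mult_ac)
    then show "\<forall>\<^sub>F y in at x. norm (norm (u y - u x - D (y - x)) / norm (y - x)) \<le> M * norm (y - x)"
      by simp
    show "((\<lambda>y. M * norm (y - x)) \<longlongrightarrow> 0) (at x)"
      by (auto intro!: tendsto_eq_intros)
  qed
  then show ?thesis
    by (simp add: has_derivative_iff_norm blinfun.bounded_linear_right)
qed

lemma C11_has_derivative:
  assumes "C11 norm L M u D"
  shows "(u has_derivative D x) (at x)"
  using assms unfolding C11_def by (intro quadratic_error_has_derivative[where M = M]) blast

lemma C11_lipschitz:
  fixes u :: "'a::real_normed_vector \<Rightarrow> 'b::real_normed_vector"
  assumes "C11 norm L M u D" "L \<ge> 0"
  shows "norm (u y - u x) \<le> L * norm (y - x)"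
proof (rule differentiable_bound[of UNIV])
  show "(u has_derivative D z) (at z within UNIV)" for z
    using C11_has_derivative[OF assms(1)] by simp
  show "onorm (D z) \<le> L" for z
    using assms by (auto simp: C11_def intro: onorm_bound)
qed auto

text \<open>The values of \<open>u\<close> at \<open>x\<close>, \<open>y\<close>, \<open>y + w\<close> with \<open>norm w = norm (x - y)\<close> determine
  \<open>(D x - D y) w\<close> up to three quadratic errors.\<close>

lemma C11_derivative_lipschitz:
  fixes u :: "'a::real_normed_vector \<Rightarrow> 'b::real_normed_vector"
  assumes u: "C11 norm L M u D"
  shows "norm (D x w - D y w) \<le> 6 * M * norm (x - y) * norm w"
proof (cases "w = 0 \<or> x = y")
  case False
  define r where "r = norm (x - y)"
  define v where "v = (r / norm w) *\<^sub>R w"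
  have r: "r > 0" and w: "norm w > 0" using False by (auto simp: r_def)
  have v: "norm v = r" using r w by (simp add: v_def)
  \<comment> \<open>\<open>C11\<close> leaves the sign of its constants open; two distinct points
    force the quadratic constant to be nonnegative.\<close>
  have M: "M \<ge> 0"
  proof -
    have "norm (u y - u x - D x (y - x)) \<le> M * (norm (y - x))\<^sup>2" using u by (auto simp: C11_def)
    from order_trans[OF norm_ge_zero this] have "0 \<le> M * r\<^sup>2"
      by (simp add: r_def norm_minus_commute)
    then show ?thesis using r by (simp add: zero_le_mult_iff)
  qed
  have q: "norm (u b - u a - D a (b - a)) \<le> M * (norm (b - a))\<^sup>2" for a b
    using u by (auto simp: C11_def)
  have "norm (y + v - x) \<le> 2 * r"
    using norm_triangle_ineq[of "y - x" v] v by (simp add: r_def norm_minus_commute algebra_simps)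
  then have "(norm (y + v - x))\<^sup>2 \<le> (2 * r)\<^sup>2" by (intro power_mono) auto
  then have 1: "norm (u (y + v) - u x - D x (y + v - x)) \<le> M * (2 * r)\<^sup>2"
    using q[of "y + v" x] M by (meson mult_left_mono order_trans)
  have 2: "norm (u (y + v) - u y - D y v) \<le> M * r\<^sup>2" using q[of "y + v" y] v by simp
  have 3: "norm (u y - u x - D x (y - x)) \<le> M * r\<^sup>2"
    using q[of y x] by (simp add: r_def norm_minus_commute)
  have D_eq: "D x v - D y v = (u (y + v) - u y - D y v) + (u y - u x - D x (y - x))
      - (u (y + v) - u x - D x (y + v - x))"
    by (simp add: blinfun.diff_right blinfun.add_right)
  \<comment> \<open>The constant 6 is 1 + 1 + 4: two increments of length \<open>r\<close> and one
    of length at most \<open>2 * r\<close>.\<close>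
  have "norm (D x v - D y v) \<le> M * r\<^sup>2 + M * r\<^sup>2 + M * (2 * r)\<^sup>2"
    unfolding D_eq using 1 2 3
      norm_triangle_ineq[of "u (y + v) - u y - D y v" "u y - u x - D x (y - x)"]
      norm_triangle_ineq4[of "(u (y + v) - u y - D y v) + (u y - u x - D x (y - x))"
        "u (y + v) - u x - D x (y + v - x)"]
    by linarith
  then have "norm (D x v - D y v) \<le> 6 * M * r * r" by (simp add: power2_eq_square algebra_simps)
  moreover have "D x v - D y v = (r / norm w) *\<^sub>R (D x w - D y w)"
    by (simp add: v_def blinfun.scaleR_right scaleR_diff_right)
  ultimately have "r / norm w * norm (D x w - D y w) \<le> 6 * M * r * r" using r w by simp
  then have "r * norm (D x w - D y w) \<le> r * (6 * M * r * norm w)" using w by (simp add: field_simps)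
  then show ?thesis using r by (simp add: r_def)
qed auto

text \<open>The contraction of I + e A holds only in a norm adapted to A, while the type has its own
  \<open>norm\<close>. The lower constant 1 lets every \<open>N\<close>-bound be read as a bound in
  \<open>norm\<close> with the same constant.\<close>

locale equivalent_norm =
  fixes N :: "'b::real_normed_vector \<Rightarrow> real" and c :: real
  assumes N_add: "N (u + v) \<le> N u + N v"
    and N_scaleR: "N (a *\<^sub>R v) = \<bar>a\<bar> * N v"
    and N_lower: "norm v \<le> N v"
    and N_upper: "N v \<le> c * norm v"
begin

lemma N_nonneg: "0 \<le> N v"
  using N_lower[of v] norm_ge_zero[of v] by linarith

lemma N_zero: "N 0 = 0"
  using N_scaleR[of 0 0] by simp

lemma C11_imp_norm: "C11 N L M u D \<Longrightarrow> C11 norm L M u D"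
  unfolding C11_def by (meson N_lower order_trans)

text \<open>Chain rule with constants. The moved argument has Lipschitz factor 1 + e L, which enters
  the derivative once and the quadratic error squared; the Taylor error of \<open>F\<close>
  contributes \<open>C1 * (e * L2)\<close>, and \<open>P\<close> multiplies all that comes from
  \<open>u\<close> by \<open>q\<close>.\<close>

lemma C11_step:
  fixes F :: "'a::real_normed_vector \<Rightarrow> 'a" and P :: "'b \<Rightarrow>\<^sub>L 'b"
  assumes P: "\<And>v. N (P v) \<le> q * N v" and q: "q \<ge> 0" and e: "e \<ge> 0"
    and G: "C11 N G1 G2 G G'"
    and F: "C11 norm L L2 F F'" and L: "L \<ge> 0" "L2 \<ge> 0"
    and u: "C11 N C1 C2 u D" and C: "C1 \<ge> 0" "C2 \<ge> 0"
  shows "C11 N (e * G1 + q * (C1 * (1 + e * L)))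
     (e * G2 + q * (C2 * (1 + e * L)\<^sup>2 + C1 * (e * L2)))
     (\<lambda>x. e *\<^sub>R G x + P (u (x - e *\<^sub>R F x)))
     (\<lambda>x. e *\<^sub>R G' x + (P o\<^sub>L D (x - e *\<^sub>R F x) o\<^sub>L (id_blinfun - e *\<^sub>R F' x)))"
  unfolding C11_def
proof (intro conjI allI)
  have Du: "N (D x w) \<le> C1 * norm w" for x w using u by (auto simp: C11_def)
  fix x w
  let ?x = "x - e *\<^sub>R F x"
  have "norm (w - e *\<^sub>R F' x w) \<le> norm w + e * norm (F' x w)"
    using norm_triangle_ineq4[of w "e *\<^sub>R F' x w"] e by simp
  also have "\<dots> \<le> norm w + e * (L * norm w)"
    using F e by (auto simp: C11_def intro!: mult_left_mono)
  finally have "norm (w - e *\<^sub>R F' x w) \<le> (1 + e * L) * norm w" by (simp add: algebra_simps)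
  then have "N (D ?x (w - e *\<^sub>R F' x w)) \<le> C1 * ((1 + e * L) * norm w)"
    using Du C by (meson mult_left_mono order_trans)
  then have 1: "N (P (D ?x (w - e *\<^sub>R F' x w))) \<le> q * (C1 * ((1 + e * L) * norm w))"
    using P q by (meson mult_left_mono order_trans)
  have "N (e *\<^sub>R G' x w) \<le> e * (G1 * norm w)"
    using G e by (auto simp: C11_def N_scaleR intro!: mult_left_mono)
  then have "N (e *\<^sub>R G' x w + P (D ?x (w - e *\<^sub>R F' x w)))
      \<le> e * (G1 * norm w) + q * (C1 * ((1 + e * L) * norm w))"
    using 1 N_add[of "e *\<^sub>R G' x w" "P (D ?x (w - e *\<^sub>R F' x w))"] by linarith
  then show "N ((e *\<^sub>R G' x + (P o\<^sub>L D ?x o\<^sub>L (id_blinfun - e *\<^sub>R F' x))) w)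
      \<le> (e * G1 + q * (C1 * (1 + e * L))) * norm w"
    by (simp add: blinfun.add_left blinfun.diff_left blinfun.scaleR_left algebra_simps)
next
  have Du: "N (D x w) \<le> C1 * norm w" for x w using u by (auto simp: C11_def)
  fix x y
  let ?x = "x - e *\<^sub>R F x" and ?y = "y - e *\<^sub>R F y"
  let ?r = "norm (y - x)"
  define s where "s = F y - F x - F' x (y - x)"
  have "?y - ?x = (y - x) - e *\<^sub>R (F y - F x)" by (simp add: algebra_simps)
  then have "norm (?y - ?x) \<le> ?r + norm (e *\<^sub>R (F y - F x))"
    by (metis norm_triangle_ineq4)
  also have "\<dots> = ?r + e * norm (F y - F x)" using e by simp
  also have "\<dots> \<le> ?r + e * (L * ?r)"
    using C11_lipschitz[OF F L(1)] e by (auto intro!: mult_left_mono)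
  finally have "norm (?y - ?x) \<le> (1 + e * L) * ?r" by (simp add: algebra_simps)
  then have "(norm (?y - ?x))\<^sup>2 \<le> (1 + e * L)\<^sup>2 * ?r\<^sup>2"
    by (metis norm_ge_zero power_mono power_mult_distrib)
  then have "C2 * (norm (?y - ?x))\<^sup>2 \<le> C2 * ((1 + e * L)\<^sup>2 * ?r\<^sup>2)"
    using C by (intro mult_left_mono)
  moreover have "N (u ?y - u ?x - D ?x (?y - ?x)) \<le> C2 * (norm (?y - ?x))\<^sup>2"
    using u unfolding C11_def by blast
  ultimately have "N (u ?y - u ?x - D ?x (?y - ?x)) \<le> C2 * ((1 + e * L)\<^sup>2 * ?r\<^sup>2)"
    by linarith
  moreover have "N (D ?x (- (e *\<^sub>R s))) \<le> C1 * (e * (L2 * ?r\<^sup>2))"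
  proof -
    have "norm s \<le> L2 * ?r\<^sup>2" using F by (auto simp: C11_def s_def)
    then have "norm (- (e *\<^sub>R s)) \<le> e * (L2 * ?r\<^sup>2)" using e by (simp add: mult_left_mono)
    then show ?thesis using Du C by (meson mult_left_mono order_trans)
  qed
  ultimately have "N ((u ?y - u ?x - D ?x (?y - ?x)) + D ?x (- (e *\<^sub>R s)))
      \<le> C2 * ((1 + e * L)\<^sup>2 * ?r\<^sup>2) + C1 * (e * (L2 * ?r\<^sup>2))"
    using N_add[of "u ?y - u ?x - D ?x (?y - ?x)" "D ?x (- (e *\<^sub>R s))"] by linarith
  then have 1: "N (P ((u ?y - u ?x - D ?x (?y - ?x)) + D ?x (- (e *\<^sub>R s))))
      \<le> q * (C2 * ((1 + e * L)\<^sup>2 * ?r\<^sup>2) + C1 * (e * (L2 * ?r\<^sup>2)))"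
    using P q by (meson mult_left_mono order_trans)
  have 2: "N (e *\<^sub>R (G y - G x - G' x (y - x))) \<le> e * (G2 * ?r\<^sup>2)"
    using G e by (auto simp: C11_def N_scaleR intro!: mult_left_mono)
  let ?a = "e *\<^sub>R (G y - G x - G' x (y - x))"
  let ?b = "P ((u ?y - u ?x - D ?x (?y - ?x)) + D ?x (- (e *\<^sub>R s)))"
  \<comment> \<open>The new Taylor error splits into that of \<open>G\<close>, that of
    \<open>u\<close> between the moved points, and \<open>D\<close> applied to the Taylor error
    \<open>s\<close> of \<open>F\<close>.\<close>
  have eq: "e *\<^sub>R G y + P (u ?y) - (e *\<^sub>R G x + P (u ?x))
      - (e *\<^sub>R G' x + (P o\<^sub>L D ?x o\<^sub>L (id_blinfun - e *\<^sub>R F' x))) (y - x)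
     = e *\<^sub>R (G y - G x - G' x (y - x)) + P ((u ?y - u ?x - D ?x (?y - ?x)) + D ?x (- (e *\<^sub>R s)))"
    by (simp add: s_def blinfun.add_left blinfun.diff_left blinfun.scaleR_left blinfun.add_right
        blinfun.diff_right blinfun.scaleR_right blinfun.minus_right algebra_simps)
  have "e * (G2 * ?r\<^sup>2) + q * (C2 * ((1 + e * L)\<^sup>2 * ?r\<^sup>2) + C1 * (e * (L2 * ?r\<^sup>2)))
      = (e * G2 + q * (C2 * (1 + e * L)\<^sup>2 + C1 * (e * L2))) * ?r\<^sup>2"
    by (simp only: distrib_left distrib_right mult.assoc)
  then show "N (e *\<^sub>R G y + P (u ?y) - (e *\<^sub>R G x + P (u ?x))
      - (e *\<^sub>R G' x + (P o\<^sub>L D ?x o\<^sub>L (id_blinfun - e *\<^sub>R F' x))) (y - x))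
     \<le> (e * G2 + q * (C2 * (1 + e * L)\<^sup>2 + C1 * (e * L2))) * ?r\<^sup>2"
    unfolding eq using 1 2 N_add[of ?a ?b] by linarith
qed

end

section \<open>The transport equation with a contracting linear part\<close>

text \<open>Tychonoff's theorem: the function type carries the topology of pointwise convergence,
  which is the product topology over the whole type.\<close>

lemma compact_Pi_UNIV:
  assumes "\<And>i. compact (K i)"
  shows "compact {p. \<forall>i. p i \<in> K i}"
proof -
  have "compactin (product_topology (\<lambda>i. euclidean) UNIV) (Pi\<^sub>E UNIV K)"
    using assms by (simp add: compactin_PiE)
  moreover have "Pi\<^sub>E UNIV K = {p. \<forall>i. p i \<in> K i}" by auto
  ultimately show ?thesis by (simp add: euclidean_product_topology)
qed

text \<open>One explicit Euler step \<open>x - e *\<^sub>R F x\<close> backwards along \<open>F\<close>: fixed points solve the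
  discretised equation. The second component propagates the derivative of the first.\<close>

definition euler_step :: "real \<Rightarrow> ('b::real_normed_vector \<Rightarrow>\<^sub>L 'b) \<Rightarrow> ('a::real_normed_vector \<Rightarrow> 'a) \<Rightarrow> ('a \<Rightarrow> 'a \<Rightarrow>\<^sub>L 'a) \<Rightarrow>
    ('a \<Rightarrow> 'b) \<Rightarrow> ('a \<Rightarrow> 'a \<Rightarrow>\<^sub>L 'b) \<Rightarrow>
    ('a \<Rightarrow> 'b) \<times> ('a \<Rightarrow> 'a \<Rightarrow>\<^sub>L 'b) \<Rightarrow> ('a \<Rightarrow> 'b) \<times> ('a \<Rightarrow> 'a \<Rightarrow>\<^sub>L 'b)" where
  "euler_step e A F F' G G' p =
     ((\<lambda>x. e *\<^sub>R G x + (id_blinfun + e *\<^sub>R A) (fst p (x - e *\<^sub>R F x))),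
      (\<lambda>x. e *\<^sub>R G' x + ((id_blinfun + e *\<^sub>R A) o\<^sub>L snd p (x - e *\<^sub>R F x)
         o\<^sub>L (id_blinfun - e *\<^sub>R F' x))))"

text \<open>The conditions on \<open>C0\<close>, \<open>C1\<close>, \<open>C2\<close> make the three
  bounds invariant under the Euler step for every admissible e, so the bounds do not depend on e.
  Increments of the iteration decay like \<open>q ^ j\<close>, and a late iterate, rather than a
  limit, serves as the approximate solution.\<close>

lemma (in equivalent_norm) approximate_transport_solution:
  fixes F :: "'a::real_normed_vector \<Rightarrow> 'a" and A :: "'b \<Rightarrow>\<^sub>L 'b"
  assumes A: "\<And>v. N (v + e *\<^sub>R A v) \<le> (1 - e * \<alpha>) * N v"
    and e: "0 < e" "e * \<alpha> < 1"
    and F: "C11 norm L L2 F F'" and L: "L \<ge> 0" "L2 \<ge> 0" and \<alpha>: "\<alpha> > 2 * L"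
    and G: "C11 N G1 G2 G G'" and G0: "\<And>x. N (G x) \<le> G0"
    and C: "C1 \<ge> 0" "C2 \<ge> 0"
    and C0: "G0 \<le> \<alpha> * C0" and C1: "G1 \<le> (\<alpha> - L) * C1" and C2: "G2 + C1 * L2 \<le> (\<alpha> - 2 * L) * C2"
  obtains u D where "\<And>x. N (u x) \<le> C0" "C11 N C1 C2 u D"
    "\<And>x. norm (D x (F x) - A (u x) - G x) \<le> e * (1 + C2 * (norm (F x))\<^sup>2 + norm A * C1 * norm (F x))"
proof -
  define q where "q = 1 - e * \<alpha>"
  have q: "0 < q" "q < 1" using e \<alpha> L by (auto simp: q_def)
  let ?P = "id_blinfun + e *\<^sub>R A"
  have P: "N (?P v) \<le> q * N v" for v
    using A[of v] by (simp add: q_def blinfun.add_left blinfun.scaleR_left)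
  define \<Phi> where "\<Phi> = euler_step e A F F' G G'"
  define p where "p j = (\<Phi> ^^ j) (\<lambda>x. 0, \<lambda>x. 0)" for j
  have G0': "0 \<le> G0" using G0 N_nonneg order_trans by blast
  have C0': "0 \<le> C0"
  proof -
    have "0 \<le> \<alpha> * C0" using G0' C0 by linarith
    then show ?thesis using \<alpha> L by (simp add: zero_le_mult_iff)
  qed
  have p_Suc: "p (Suc j) = \<Phi> (p j)" for j by (simp add: p_def)
  have fst_Suc: "fst (p (Suc j)) x = e *\<^sub>R G x + ?P (fst (p j) (x - e *\<^sub>R F x))" for j x
    by (simp add: p_Suc \<Phi>_def euler_step_def)
  \<comment> \<open>The contraction 1 - e \<alpha> combined with a loss 1 + e L per order leaves at
    most 1 - e (\<alpha> - L) here and 1 - e (\<alpha> - 2 L) in \<open>c2\<close>; the discarded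
    second-order terms have the right sign.\<close>
  have c1: "e * G1 + q * (C1 * (1 + e * L)) \<le> C1"
  proof -
    have "e * G1 \<le> e * ((\<alpha> - L) * C1)" using C1 e by simp
    moreover have "0 \<le> e * e * \<alpha> * L * C1" using e \<alpha> L C by simp
    ultimately show ?thesis by (simp add: q_def algebra_simps)
  qed
  have c2: "e * G2 + q * (C2 * (1 + e * L)\<^sup>2 + C1 * (e * L2)) \<le> C2"
  proof -
    have a: "q * (1 + e * L) \<le> 1 - e * (\<alpha> - L)" using e \<alpha> L by (simp add: q_def algebra_simps)
    have "q * (1 + e * L)\<^sup>2 = q * (1 + e * L) * (1 + e * L)" by (simp add: power2_eq_square)
    also have "\<dots> \<le> (1 - e * (\<alpha> - L)) * (1 + e * L)" using a e L by (intro mult_right_mono) auto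
    also have "\<dots> \<le> 1 - e * (\<alpha> - 2 * L)"
    proof -
      have "0 \<le> e * e * L * (\<alpha> - L)" using e L \<alpha> by simp
      then show ?thesis by (simp add: algebra_simps)
    qed
    finally have "q * (1 + e * L)\<^sup>2 * C2 \<le> (1 - e * (\<alpha> - 2 * L)) * C2"
      using C by (intro mult_right_mono)
    moreover have "q * (C1 * (e * L2)) \<le> C1 * (e * L2)"
      using q C e L by (simp add: mult_left_le_one_le)
    moreover have "e * (G2 + C1 * L2) \<le> e * ((\<alpha> - 2 * L) * C2)" using C2 e by simp
    ultimately show ?thesis by (simp add: algebra_simps)
  qed
  have inv: "(\<forall>x. N (fst (p j) x) \<le> C0) \<and> C11 N C1 C2 (fst (p j)) (snd (p j))" for j
  proof (induction j)
    case 0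
    then show ?case using C C0' by (simp add: p_def C11_def N_zero)
  next
    case (Suc j)
    have "N (fst (p (Suc j)) x) \<le> C0" for x
    proof -
      have "N (fst (p (Suc j)) x) \<le> N (e *\<^sub>R G x) + N (?P (fst (p j) (x - e *\<^sub>R F x)))"
        unfolding fst_Suc by (rule N_add)
      also have "\<dots> \<le> e * (\<alpha> * C0) + q * C0"
      proof (rule add_mono)
        have "N (G x) \<le> \<alpha> * C0" using G0 C0 order_trans by blast
        then show "N (e *\<^sub>R G x) \<le> e * (\<alpha> * C0)" using e by (simp add: N_scaleR)
        show "N (?P (fst (p j) (x - e *\<^sub>R F x))) \<le> q * C0"
          using P q Suc by (meson mult_left_mono less_imp_le order_trans)
      qed
      finally show ?thesis by (simp add: q_def algebra_simps)
    qed
    moreover have "C11 N C1 C2 (fst (p (Suc j))) (snd (p (Suc j)))"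
    proof -
      have "C11 N (e * G1 + q * (C1 * (1 + e * L))) (e * G2 + q * (C2 * (1 + e * L)\<^sup>2 + C1 * (e * L2)))
        (fst (p (Suc j))) (snd (p (Suc j)))"
        unfolding p_Suc \<Phi>_def euler_step_def fst_conv snd_conv
        by (rule C11_step[OF P _ _ G F L _ C]) (use Suc q e in auto)
      then show ?thesis
        unfolding C11_def using c1 c2 by (meson mult_right_mono norm_ge_zero zero_le_power2 order_trans)
    qed
    ultimately show ?case by simp
  qed
  have diff: "N (fst (p (Suc j)) x - fst (p j) x) \<le> q ^ j * (e * G0)" for j x
  proof (induction j arbitrary: x)
    case 0
    then show ?case using G0 e by (simp add: fst_Suc) (simp add: p_def N_scaleR)
  next
    case (Suc j)
    let ?x = "x - e *\<^sub>R F x"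
    have "fst (p (Suc (Suc j))) x - fst (p (Suc j)) x = ?P (fst (p (Suc j)) ?x - fst (p j) ?x)"
      by (simp add: fst_Suc[of "Suc j" x] fst_Suc[of j x] blinfun.diff_right)
    then show ?case
      using P[of "fst (p (Suc j)) ?x - fst (p j) ?x"] Suc[of ?x] q
      by (simp add: mult.assoc) (meson mult_left_mono less_imp_le order_trans)
  qed
  \<comment> \<open>The increment is pushed below \<open>e * e\<close> because it is divided by
    \<open>e\<close> in the residual; this gives the summand 1 of the final bound.\<close>
  have "(\<lambda>j. q ^ j * (e * G0)) \<longlonglongrightarrow> 0"
    using q by (intro tendsto_mult_left_zero LIMSEQ_power_zero) auto
  then have "\<forall>\<^sub>F j in sequentially. q ^ j * (e * G0) < e * e"
    using e by (intro order_tendstoD) auto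
  then obtain j where j: "q ^ j * (e * G0) < e * e"
    by (auto simp: eventually_sequentially)
  define u where "u = fst (p j)"
  define D where "D = snd (p j)"
  have u0: "N (u x) \<le> C0" for x using inv[of j] by (auto simp: u_def)
  have u1: "C11 N C1 C2 u D" using inv[of j] by (auto simp: u_def D_def)
  have "norm (D x (F x) - A (u x) - G x) \<le> e * (1 + C2 * (norm (F x))\<^sup>2 + norm A * C1 * norm (F x))" for x
  proof -
    let ?x = "x - e *\<^sub>R F x"
    \<comment> \<open>\<open>d\<close> is the Taylor error over one Euler step and \<open>r\<close>
      the defect of the fixed-point equation. Both are of order \<open>e * e\<close>, as is the term
      that moves \<open>A\<close> from the shifted point back to \<open>x\<close>.\<close>
    define d where "d = u ?x - u x - D x (?x - x)"
    define r where "r = e *\<^sub>R G x + ?P (u ?x) - u x"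
    have d: "norm d \<le> C2 * (e * norm (F x))\<^sup>2"
    proof -
      have "norm d \<le> C2 * (norm (?x - x))\<^sup>2"
        using C11_imp_norm[OF u1] unfolding C11_def d_def by blast
      then show ?thesis using e by simp
    qed
    have "norm r \<le> q ^ j * (e * G0)"
      using diff[of j x] N_lower[of r] by (simp add: r_def u_def fst_Suc)
    then have r: "norm r \<le> e * e" using j by linarith
    have "norm (u ?x - u x) \<le> C1 * norm (?x - x)"
      using C11_imp_norm[OF u1] C by (intro C11_lipschitz) auto
    then have "norm (u ?x - u x) \<le> C1 * (e * norm (F x))" using e by simp
    then have a: "norm (A (u ?x - u x)) \<le> norm A * (C1 * (e * norm (F x)))"
      by (meson mult_left_mono norm_blinfun norm_ge_zero order_trans)
    have "e *\<^sub>R (D x (F x) - A (u x) - G x) = d - r + e *\<^sub>R A (u ?x - u x)"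
      by (simp add: d_def r_def blinfun.diff_right blinfun.scaleR_right blinfun.minus_right blinfun.add_left
          blinfun.scaleR_left algebra_simps)
    then have "norm (e *\<^sub>R (D x (F x) - A (u x) - G x)) \<le> norm d + norm r + norm (e *\<^sub>R A (u ?x - u x))"
      using norm_triangle_ineq[of "d - r" "e *\<^sub>R A (u ?x - u x)"] norm_triangle_ineq4[of d r] by simp
    then have "e * norm (D x (F x) - A (u x) - G x) \<le> norm d + norm r + e * norm (A (u ?x - u x))"
      using e by simp
    also have "\<dots> \<le> C2 * (e * norm (F x))\<^sup>2 + e * e + e * (norm A * (C1 * (e * norm (F x))))"
      using d r a e by (intro add_mono mult_left_mono) auto
    also have "\<dots> = e * (e * (1 + C2 * (norm (F x))\<^sup>2 + norm A * C1 * norm (F x)))"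
      by (simp add: algebra_simps power2_eq_square)
    finally show ?thesis using e by simp
  qed
  then show ?thesis using that u0 u1 by blast
qed

text \<open>The approximate solutions with step at most \<open>e\<close> lie in a closed subset of a product of compact balls,
  because the derivative is carried along and all conditions are pointwise. By Tychonoff these
  nested sets have a common point.\<close>

lemma transport_solution:
  fixes F :: "'a::euclidean_space \<Rightarrow> 'a" and A :: "'b::euclidean_space \<Rightarrow>\<^sub>L 'b"
  assumes N: "equivalent_norm N c"
    and A: "\<And>e v. 0 < e \<Longrightarrow> e \<le> e0 \<Longrightarrow> N (v + e *\<^sub>R A v) \<le> (1 - e * \<alpha>) * N v" and e0: "e0 > 0"
    and F: "C11 norm L L2 F F'" and L: "L \<ge> 0" "L2 \<ge> 0" and \<alpha>: "\<alpha> > 2 * L"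
    and G: "C11 N G1 G2 G G'" "G1 \<ge> 0" "G2 \<ge> 0" and G0: "\<And>x. N (G x) \<le> G0"
  obtains S D M where "C11 norm (G1 / (\<alpha> - L)) M S D"
    "\<And>x. D x (F x) = A (S x) + G x"
proof -
  interpret equivalent_norm N c by (rule N)
  define C0 where "C0 = G0 / \<alpha>"
  define C1 where "C1 = G1 / (\<alpha> - L)"
  define C2 where "C2 = (G2 + C1 * L2) / (\<alpha> - 2 * L)"
  have \<alpha>0: "\<alpha> > 0" "\<alpha> - L > 0" using \<alpha> L by linarith+
  have C: "C1 \<ge> 0" "C2 \<ge> 0" using \<alpha> \<alpha>0 L G by (auto simp: C1_def C2_def)
  \<comment> \<open>The second entry gives e \<alpha> \<le> 1/2, so the contraction factor stays
    positive.\<close>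
  define es where "es = min e0 (1 / (2 * \<alpha>))"
  have es: "0 < es" using e0 \<alpha>0 by (simp add: es_def)
  define \<epsilon> where "\<epsilon> n = es / (real n + 1)" for n :: nat
  have \<epsilon>: "0 < \<epsilon> n" "\<epsilon> n \<le> es" for n using es by (auto simp: \<epsilon>_def field_simps)
  have \<epsilon>_mono: "\<epsilon> m \<le> \<epsilon> n" if "n \<le> m" for m n
    using that es by (auto simp: \<epsilon>_def intro!: divide_left_mono)
  define W where "W x = 1 + C2 * (norm (F x))\<^sup>2 + norm A * C1 * norm (F x)" for x
  have W: "W x \<ge> 0" for x using C by (simp add: W_def)
  \<comment> \<open>A point \<open>p\<close> packs values and derivatives, so \<open>Q\<close> is a
    product of balls in finite-dimensional spaces. Every constraint in \<open>R n\<close> involves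
    at most two arguments of \<open>p\<close> and is therefore closed for pointwise
    convergence.\<close>
  define Q where "Q = {p :: 'a \<Rightarrow> 'b \<times> ('a \<Rightarrow>\<^sub>L 'b). \<forall>x. p x \<in> cball 0 C0 \<times> cball 0 C1}"
  define R where "R n = {p :: 'a \<Rightarrow> 'b \<times> ('a \<Rightarrow>\<^sub>L 'b).
    (\<forall>x y. norm (fst (p y) - fst (p x) - blinfun_apply (snd (p x)) (y - x)) \<le> C2 * (norm (y - x))\<^sup>2) \<and>
    (\<forall>x. norm (blinfun_apply (snd (p x)) (F x) - A (fst (p x)) - G x) \<le> \<epsilon> n * W x)}" for n
  have "Q \<inter> (\<Inter>n. R n) \<noteq> {}"
  proof (rule compact_imp_fip_image)
    show "compact Q" unfolding Q_def by (intro compact_Pi_UNIV compact_Times compact_cball)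
    have fst_cont: "continuous_on UNIV (\<lambda>p :: 'a \<Rightarrow> 'b \<times> ('a \<Rightarrow>\<^sub>L 'b). fst (p x))" for x
      by (intro continuous_on_fst continuous_on_product_coordinates)
    have snd_cont: "continuous_on UNIV (\<lambda>p :: 'a \<Rightarrow> 'b \<times> ('a \<Rightarrow>\<^sub>L 'b). blinfun_apply (snd (p x)) w)" for x w
      by (intro bounded_linear.continuous_on[OF blinfun.bounded_linear_left] continuous_on_snd
          continuous_on_product_coordinates)
    have A_cont: "continuous_on UNIV (\<lambda>p :: 'a \<Rightarrow> 'b \<times> ('a \<Rightarrow>\<^sub>L 'b). A (fst (p x)))" for x
      by (rule bounded_linear.continuous_on[OF blinfun.bounded_linear_right fst_cont])
    define R1 where "R1 x y = {p :: 'a \<Rightarrow> 'b \<times> ('a \<Rightarrow>\<^sub>L 'b).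
        norm (fst (p y) - fst (p x) - blinfun_apply (snd (p x)) (y - x)) \<le> C2 * (norm (y - x))\<^sup>2}" for x y
    define R2 where "R2 n x = {p :: 'a \<Rightarrow> 'b \<times> ('a \<Rightarrow>\<^sub>L 'b).
        norm (blinfun_apply (snd (p x)) (F x) - A (fst (p x)) - G x) \<le> \<epsilon> n * W x}" for n x
    have "closed (R1 x y)" for x y
      unfolding R1_def
      by (rule closed_Collect_le[OF continuous_on_norm[OF continuous_on_diff[OF
              continuous_on_diff[OF fst_cont fst_cont] snd_cont]] continuous_on_const])
    moreover have "closed (R2 n x)" for n x
      unfolding R2_def
      by (rule closed_Collect_le[OF continuous_on_norm[OF continuous_on_diff[OF
              continuous_on_diff[OF snd_cont A_cont] continuous_on_const]] continuous_on_const])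
    moreover have "R n = (\<Inter>x. \<Inter>y. R1 x y) \<inter> (\<Inter>x. R2 n x)" for n
      by (auto simp: R_def R1_def R2_def)
    ultimately show "closed (R n)" for n
      by (simp add: closed_Int closed_INT)
    show "Q \<inter> (\<Inter>n\<in>I. R n) \<noteq> {}" if "finite I" for I
    proof -
      \<comment> \<open>The sets \<open>R n\<close> shrink with \<open>n\<close>, so the approximate
        solution with the smallest step meets all constraints from \<open>I\<close>; for empty
        \<open>I\<close> any \<open>m\<close> serves.\<close>
      define m where "m = Max I"
      have m: "n \<le> m" if "n \<in> I" for n
        using \<open>finite I\<close> that by (simp add: m_def)
      have "\<epsilon> m * \<alpha> < 1"
      proof -
        have "\<epsilon> m * \<alpha> \<le> 1 / (2 * \<alpha>) * \<alpha>"
          using \<epsilon>[of m] \<alpha>0 by (intro mult_right_mono) (auto simp: es_def)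
        also have "\<dots> < 1" using \<alpha>0 by simp
        finally show ?thesis .
      qed
      moreover have "N (v + \<epsilon> m *\<^sub>R A v) \<le> (1 - \<epsilon> m * \<alpha>) * N v" for v
        using A \<epsilon>[of m] by (simp add: es_def)
      moreover have "G0 \<le> \<alpha> * C0" "G1 \<le> (\<alpha> - L) * C1" "G2 + C1 * L2 \<le> (\<alpha> - 2 * L) * C2"
        using \<alpha>0 \<alpha> by (auto simp: C0_def C1_def C2_def)
      ultimately obtain u D where u: "\<And>x. N (u x) \<le> C0" "C11 N C1 C2 u D"
        "\<And>x. norm (D x (F x) - A (u x) - G x) \<le> \<epsilon> m * W x"
        unfolding W_def
        using approximate_transport_solution[OF _ \<epsilon>(1) _ F L \<alpha> G(1) G0 C] by metis
      have u': "C11 norm C1 C2 u D" using u(2) by (rule C11_imp_norm)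
      have "norm (u x) \<le> C0" for x using u(1) N_lower order_trans by blast
      moreover have "norm (D x) \<le> C1" for x
        using u' C by (intro norm_blinfun_bound) (auto simp: C11_def)
      ultimately have "(\<lambda>x. (u x, D x)) \<in> Q" by (simp add: Q_def)
      moreover have "(\<lambda>x. (u x, D x)) \<in> R n" if "n \<in> I" for n
      proof -
        have "norm (D x (F x) - A (u x) - G x) \<le> \<epsilon> n * W x" for x
          using u(3)[of x] mult_right_mono[OF \<epsilon>_mono[OF m[OF that]] W[of x]] by linarith
        then show ?thesis using u' by (simp add: R_def C11_def)
      qed
      ultimately show ?thesis by blast
    qed
  qed
  then obtain p where p: "p \<in> Q" "\<And>n. p \<in> R n" by blast
  define S where "S = fst \<circ> p"
  define D where "D = snd \<circ> p"
  have "norm (D x w) \<le> C1 * norm w" for x w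
  proof -
    have "norm (D x) \<le> C1" using p(1) by (auto simp: Q_def D_def mem_Times_iff)
    then show ?thesis by (meson mult_right_mono norm_blinfun norm_ge_zero order_trans)
  qed
  then have "C11 norm C1 C2 S D" using p(2) by (simp add: C11_def R_def S_def D_def)
  moreover have "D x (F x) = A (S x) + G x" for x
  proof -
    have "norm (D x (F x) - A (S x) - G x) \<le> 0"
    proof (rule LIMSEQ_le_const)
      have "(\<lambda>n. es * (1 / real (Suc n)) * W x) \<longlonglongrightarrow> es * 0 * W x"
        by (intro tendsto_intros LIMSEQ_Suc lim_1_over_n)
      then show "(\<lambda>n. \<epsilon> n * W x) \<longlonglongrightarrow> 0" by (simp add: \<epsilon>_def add.commute)
      show "\<exists>n0. \<forall>n\<ge>n0. norm (D x (F x) - A (S x) - G x) \<le> \<epsilon> n * W x"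
        using p(2) by (simp add: R_def S_def D_def)
    qed
    then show ?thesis by (simp add: algebra_simps)
  qed
  ultimately show ?thesis using that by (auto simp: C1_def)
qed

section \<open>Norms adapted to a Hurwitz matrix\<close>

definition poly_apply :: "complex poly \<Rightarrow> complex^'m^'m \<Rightarrow> complex^'m \<Rightarrow> complex^'m" where
  "poly_apply p A v = (\<Sum>i\<le>degree p. coeff p i *s (((*v) A) ^^ i) v)"

lemma poly_apply_altdef:
  assumes "degree p \<le> n"
  shows "poly_apply p A v = (\<Sum>i\<le>n. coeff p i *s (((*v) A) ^^ i) v)"
  unfolding poly_apply_def using assms
  by (intro sum.mono_neutral_left) (auto simp: coeff_eq_0)

lemma matrix_vector_sum_right: "A *v (\<Sum>i\<in>I. x i) = (\<Sum>i\<in>I. A *v x i)"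
  for A :: "complex^'n^'m"
  by (induction I rule: infinite_finite_induct) (auto simp: matrix_vector_right_distrib)

text \<open>Multiplication by X shifts the coefficients, which amounts to one application of
  \<open>A\<close>. This peels one root off an annihilating polynomial.\<close>

lemma poly_apply_linear_factor:
  fixes A :: "complex^'m^'m"
  shows "poly_apply ([:-\<mu>, 1:] * q) A v = A *v poly_apply q A v - \<mu> *s poly_apply q A v"
proof -
  define n where "n = degree q"
  have "degree ([:-\<mu>, 1:] * q) \<le> Suc n"
    using degree_mult_le[of "[:-\<mu>, 1:]" q] by (simp add: n_def)
  then have "poly_apply ([:-\<mu>, 1:] * q) A v
      = (\<Sum>i\<le>Suc n. coeff ([:-\<mu>, 1:] * q) i *s (((*v) A) ^^ i) v)"
    by (rule poly_apply_altdef)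
  also have "\<dots> = (\<Sum>i\<le>Suc n. coeff (pCons 0 q) i *s (((*v) A) ^^ i) v)
      - (\<Sum>i\<le>Suc n. \<mu> *s (coeff q i *s (((*v) A) ^^ i) v))"
    by (simp add: sum_subtractf[symmetric] vector_sub_rdistrib vector_smult_assoc algebra_simps
        del: sum.atMost_Suc)
  also have "(\<Sum>i\<le>Suc n. coeff (pCons 0 q) i *s (((*v) A) ^^ i) v) = A *v poly_apply q A v"
    by (subst sum.atMost_Suc_shift)
      (simp add: poly_apply_def n_def matrix_vector_sum_right vec.scale)
  also have "(\<Sum>i\<le>Suc n. \<mu> *s (coeff q i *s (((*v) A) ^^ i) v)) = \<mu> *s poly_apply q A v"
    by (subst poly_apply_altdef[of q "Suc n"]) (simp_all add: n_def vec.scale_sum_right)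
  finally show ?thesis .
qed

lemma poly_apply_matrix_commute:
  fixes A :: "complex^'m^'m"
  shows "poly_apply q A (A *v v) = A *v poly_apply q A v"
  by (simp add: poly_apply_def matrix_vector_sum_right vec.scale funpow_swap1)

lemma poly_apply_diff_scale:
  fixes A :: "complex^'m^'m"
  shows "poly_apply q A (u - \<mu> *s v) = poly_apply q A u - \<mu> *s poly_apply q A v"
proof -
  have "(((*v) A) ^^ i) (u - \<mu> *s v) = (((*v) A) ^^ i) u - \<mu> *s (((*v) A) ^^ i) v" for i
    by (induction i) (auto simp: matrix_vector_mult_diff_distrib vec.scale)
  then show ?thesis
    by (simp add: poly_apply_def sum_subtractf vec.scale_sum_right vec.scale_right_diff_distrib
        mult.commute)
qed

text \<open>A set does not see repetitions: if two terms coincide, the coefficients 1 and -1 give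
  the relation; otherwise the image has more than DIM elements and is dependent.\<close>

lemma nontrivial_relation:
  fixes x :: "nat \<Rightarrow> 'a::euclidean_space"
  obtains c :: "nat \<Rightarrow> real" and i where "i \<le> DIM('a)" "c i \<noteq> 0" "(\<Sum>i\<le>DIM('a). c i *\<^sub>R x i) = 0"
proof (cases "inj_on x {..DIM('a)}")
  case True
  then have "card (x ` {..DIM('a)}) > DIM('a)" by (simp add: card_image)
  then have "dependent (x ` {..DIM('a)})" by (intro dependent_biggerset) auto
  then obtain u v where u: "v \<in> x ` {..DIM('a)}" "u v \<noteq> 0" "(\<Sum>v\<in>x ` {..DIM('a)}. u v *\<^sub>R v) = 0"
    by (auto simp: dependent_finite)
  then obtain i where "i \<le> DIM('a)" "v = x i" by auto
  moreover have "(\<Sum>i\<le>DIM('a). u (x i) *\<^sub>R x i) = 0"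
    using u(3) by (simp add: sum.reindex[OF True] o_def)
  ultimately show ?thesis using that[of i "u \<circ> x"] u by simp
next
  case False
  then obtain i j where ij: "i \<le> DIM('a)" "j \<le> DIM('a)" "i \<noteq> j" "x i = x j"
    by (auto simp: inj_on_def)
  define c :: "nat \<Rightarrow> real" where "c k = (if k = i then 1 else 0) - (if k = j then 1 else 0)" for k
  have "(\<Sum>k\<le>DIM('a). c k *\<^sub>R x k) = 0"
    using ij by (simp add: c_def scaleR_diff_left sum_subtractf if_distrib[of "\<lambda>a. a *\<^sub>R _"]
        sum.delta cong: if_cong)
  moreover have "c i \<noteq> 0" using ij by (simp add: c_def)
  ultimately show ?thesis using that ij by blast
qed

lemma scaleR_eq_scale: "a *\<^sub>R w = complex_of_real a *s w" for w :: "complex^'m"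
  by (simp add: vec_eq_iff complex_eq_iff)

lemma norm_scale_vec: "norm (a *s w) = cmod a * norm w" for w :: "complex^'m"
  by (simp add: norm_vec_def norm_mult L2_set_right_distrib)

text \<open>The iterates of \<open>v\<close> under \<open>A\<close> live in a space of finite real
  dimension, so DIM + 1 of them satisfy a real relation, whose coefficients form \<open>p\<close>.
  The polynomial may depend on \<open>v\<close>.\<close>

lemma annihilating_polynomial:
  fixes A :: "complex^'m^'m"
  obtains p where "p \<noteq> 0" "poly_apply p A v = 0"
proof -
  define n where "n = DIM(complex^'m)"
  obtain c :: "nat \<Rightarrow> real" and i where c: "i \<le> n" "c i \<noteq> 0"
    "(\<Sum>i\<le>n. c i *\<^sub>R (((*v) A) ^^ i) v) = 0"
    unfolding n_def by (rule nontrivial_relation[of "\<lambda>i. (((*v) A) ^^ i) v"])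
  define p where "p = (\<Sum>i\<le>n. monom (complex_of_real (c i)) i)"
  have coeff: "coeff p k = (if k \<le> n then complex_of_real (c k) else 0)" for k
    by (simp add: p_def coeff_sum)
  have "degree p \<le> n" by (intro degree_le) (simp add: coeff)
  then have "poly_apply p A v = 0"
    using c(3) by (auto simp: poly_apply_altdef coeff scaleR_eq_scale)
  moreover have "coeff p i \<noteq> 0" using c by (simp add: coeff)
  then have "p \<noteq> 0" by auto
  ultimately show ?thesis using that by blast
qed

definition euler_map :: "('b::real_vector \<Rightarrow> 'b) \<Rightarrow> real \<Rightarrow> 'b \<Rightarrow> 'b" where
  "euler_map A e v = v + e *\<^sub>R A v"

text \<open>I + e A commutes with A - \<mu>, which links the orbit of \<open>v\<close> to that of (A
  - \<mu>) v.\<close>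

lemma euler_map_funpow_commute:
  fixes A :: "complex^'m^'m"
  shows "(euler_map ((*v) A) e ^^ j) (A *v v - \<mu> *s v)
    = A *v (euler_map ((*v) A) e ^^ j) v - \<mu> *s (euler_map ((*v) A) e ^^ j) v"
  by (induction j)
    (simp_all add: euler_map_def scaleR_eq_scale matrix_vector_mult_diff_distrib
      matrix_vector_right_distrib vec.scale vec.scale_right_distrib vec.scale_right_diff_distrib
      vec.scale_left_commute)

text \<open>For \<open>a = r\<close> the recursion can grow like j r^j. A rate \<open>t\<close>
  strictly above \<open>max a r\<close> absorbs the factor j, with \<open>K\<close> so large that
  \<open>C\<close> is at most (t - s) K.\<close>

lemma perturbed_geometric_bound:
  fixes x :: "nat \<Rightarrow> real"
  assumes "0 \<le> a" "a < 1" "0 \<le> r" "r < 1" "0 \<le> C"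
    and "\<And>j. x (Suc j) \<le> a * x j + C * r ^ j"
  obtains K t where "0 \<le> t" "t < 1" "\<And>j. x j \<le> K * t ^ j"
proof -
  define s where "s = max a r"
  define t where "t = (1 + s) / 2"
  have s: "0 \<le> s" "s < 1" "a \<le> s" "r \<le> s" using assms by (auto simp: s_def)
  have t: "0 < t" "t < 1" "s < t" using s by (auto simp: t_def)
  define K where "K = max (max 0 (x 0)) (C / (t - s))"
  have K: "0 \<le> K" "x 0 \<le> K" by (auto simp: K_def)
  have "C / (t - s) \<le> K" by (simp add: K_def)
  then have "C \<le> (t - s) * K" using t by (simp add: pos_divide_le_eq mult.commute)
  note K = K this
  have "x j \<le> K * t ^ j" for j
  proof (induction j)
    case (Suc j)
    have "a * x j \<le> a * (K * t ^ j)" using Suc assms by (intro mult_left_mono)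
    also have "\<dots> \<le> s * (K * t ^ j)" using s K t by (intro mult_right_mono) auto
    finally have 1: "a * x j \<le> s * (K * t ^ j)" .
    have "C * r ^ j \<le> C * t ^ j" using assms s t by (intro mult_left_mono power_mono) auto
    also have "\<dots> \<le> (t - s) * K * t ^ j" using K t by (intro mult_right_mono) auto
    finally have "x (Suc j) \<le> s * (K * t ^ j) + (t - s) * K * t ^ j" using 1 assms(6)[of j] by linarith
    then show ?case by (simp add: algebra_simps)
  qed (use K in simp)
  then show ?thesis using that t by (meson less_imp_le)
qed

definition geometric_decay :: "(nat \<Rightarrow> 'a::real_normed_vector) \<Rightarrow> bool" where
  "geometric_decay x \<longleftrightarrow> (\<exists>C r. 0 \<le> r \<and> r < 1 \<and> (\<forall>j. norm (x j) \<le> C * r ^ j))"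

text \<open>A root \<open>\<mu>\<close> of an annihilating polynomial of \<open>v\<close> either is an eigenvalue, and then the factor \<open>X - \<mu>\<close> is
  absorbed by solving a scalar recursion, or the factor can be dropped.\<close>

lemma euler_map_decay:
  fixes A :: "complex^'m^'m"
  assumes A: "\<And>c v. v \<noteq> 0 \<Longrightarrow> A *v v = c *s v \<Longrightarrow> Re c < 0"
  assumes "p \<noteq> 0" "poly_apply p A v = 0"
  shows "\<exists>e0>0. \<forall>e. 0 < e \<and> e \<le> e0 \<longrightarrow>
    geometric_decay (\<lambda>j. (euler_map ((*v) A) e ^^ j) v)"
  using assms(2,3)
proof (induction "degree p" arbitrary: p v)
  case 0
  then have "v = 0"
    by (auto simp: poly_apply_def elim!: degree_eq_zeroE) 
  moreover have "(euler_map ((*v) A) e ^^ j) 0 = 0" for e j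
    by (induction j) (auto simp: euler_map_def)
  ultimately have "geometric_decay (\<lambda>j. (euler_map ((*v) A) e ^^ j) v)" for e
    unfolding geometric_decay_def by (intro exI[of _ 0]) auto
  then show ?case by (intro exI[of _ 1]) auto
next
  case (Suc d)
  then obtain \<mu> where "poly p \<mu> = 0"
    using fundamental_theorem_of_algebra[of p] by (auto simp: constant_degree)
  then obtain q where p: "p = [:-\<mu>, 1:] * q" by (auto simp: poly_eq_0_iff_dvd)
  have "q \<noteq> 0" using Suc.prems(1) p by auto
  then have "degree p = 1 + degree q" unfolding p by (subst degree_mult_eq) auto
  with \<open>q \<noteq> 0\<close> Suc.hyps(2) have q: "q \<noteq> 0" "d = degree q" by auto
  show ?case
  proof (cases "Re \<mu> < 0")
    case False
    \<comment> \<open>The vector q(A) v lies in the kernel of A - \<mu>; if nonzero, it would be an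
      eigenvector whose eigenvalue has nonnegative real part.\<close>
    have "A *v poly_apply q A v = \<mu> *s poly_apply q A v"
      using Suc.prems(2) by (simp add: p poly_apply_linear_factor del: mult_pCons_left)
    then have "poly_apply q A v = 0" using A False by blast
    then show ?thesis by (rule Suc.hyps(1)[OF q(2,1)])
  next
    case True
    define w where "w = A *v v - \<mu> *s v"
    have "poly_apply q A w = 0"
      using Suc.prems(2) unfolding p w_def
      by (simp only: poly_apply_linear_factor poly_apply_diff_scale poly_apply_matrix_commute)
    from Suc.hyps(1)[OF q(2,1) this] obtain e1 where e1: "e1 > 0" "\<forall>e. 0 < e \<and> e \<le> e1 \<longrightarrow>
      geometric_decay (\<lambda>j. (euler_map ((*v) A) e ^^ j) w)"
      by (elim exE conjE)
    \<comment> \<open>Since |1 + e \<mu>|^2 = 1 + 2 e Re \<mu> + e^2 |\<mu>|^2, the factor is below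
      1 as soon as e |\<mu>|^2 \<le> - Re \<mu>.\<close>
    define e0 where "e0 = min e1 (- Re \<mu> / (cmod \<mu>)\<^sup>2)"
    have \<mu>: "cmod \<mu> > 0" using True by auto
    have "e0 > 0" using e1 True \<mu> by (auto simp: e0_def divide_neg_pos)
    moreover have "geometric_decay (\<lambda>j. (euler_map ((*v) A) e ^^ j) v)"
      if e: "0 < e" "e \<le> e0" for e
    proof -
      obtain C r where r: "0 \<le> r" "r < 1" and C: "\<And>j. norm ((euler_map ((*v) A) e ^^ j) w) \<le> C * r ^ j"
        proof -
        have "geometric_decay (\<lambda>j. (euler_map ((*v) A) e ^^ j) w)"
          using e1(2) e by (simp add: e0_def)
        then show ?thesis using that unfolding geometric_decay_def by blast
      qed
      have C0: "C \<ge> 0" using order_trans[OF norm_ge_zero C[of 0]] by simp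
      define a where "a = cmod (1 + e *\<^sub>R \<mu>)"
      have "a < 1"
      proof -
        have "e * (cmod \<mu>)\<^sup>2 \<le> - Re \<mu>" using e \<mu> by (simp add: e0_def field_simps)
        then have "e * (e * (cmod \<mu>)\<^sup>2) \<le> e * (- Re \<mu>)" using e by (intro mult_left_mono) auto
        moreover have "e * Re \<mu> < 0" using e True by (simp add: mult_pos_neg)
        moreover have "a\<^sup>2 = 1 + 2 * (e * Re \<mu>) + e * (e * (cmod \<mu>)\<^sup>2)"
          unfolding a_def cmod_power2 by (simp add: algebra_simps power2_eq_square)
        ultimately have "a\<^sup>2 < 1" by linarith
        then show ?thesis by (simp add: a_def abs_square_less_1)
      qed
      define x where "x j = norm ((euler_map ((*v) A) e ^^ j) v)" for j
      \<comment> \<open>The orbit of \<open>v\<close> obeys a scalar recursion with multiplier 1 + e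
        \<mu>, driven by the orbit of \<open>w\<close>, which decays by induction.\<close>
      have rec: "x (Suc j) \<le> a * x j + (e * C) * r ^ j" for j
      proof -
        let ?v = "(euler_map ((*v) A) e ^^ j) v" and ?w = "(euler_map ((*v) A) e ^^ j) w"
        have w: "?w = A *v ?v - \<mu> *s ?v" by (simp add: w_def euler_map_funpow_commute)
        have "(euler_map ((*v) A) e ^^ Suc j) v = (1 + e *\<^sub>R \<mu>) *s ?v + e *\<^sub>R ?w"
          unfolding w by (simp add: euler_map_def scaleR_eq_scale vec.scale_left_distrib
              vec.scale_right_diff_distrib scaleR_conv_of_real)
        then have "x (Suc j) \<le> norm ((1 + e *\<^sub>R \<mu>) *s ?v) + norm (e *\<^sub>R ?w)"
          unfolding x_def by (metis norm_triangle_ineq)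
        also have "norm ((1 + e *\<^sub>R \<mu>) *s ?v) = a * x j"
          by (simp only: a_def x_def norm_scale_vec)
        also have "norm (e *\<^sub>R ?w) \<le> e * (C * r ^ j)" using C[of j] e by simp
        finally show ?thesis by (simp add: algebra_simps)
      qed
      have "0 \<le> a" "0 \<le> e * C" using e C0 by (auto simp: a_def)
      then obtain K t where "0 \<le> t" "t < 1" "\<And>j. x j \<le> K * t ^ j"
        using perturbed_geometric_bound[OF _ \<open>a < 1\<close> r _ rec] by metis
      then show ?thesis unfolding geometric_decay_def x_def by blast
    qed
    ultimately show ?thesis by blast
  qed
qed

text \<open>Complexification is an isometric embedding that commutes with the Euler map. The step
  and the rate obtained there depend on the vector; a finite basis makes both uniform.\<close>

lemma hurwitz_euler_map_decay:
  fixes A :: "real^'m^'m"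
  assumes "hurwitz A"
  obtains e r C where "e > 0" "0 < r" "r < 1"
    "\<forall>j v. norm ((euler_map ((*v) A) e ^^ j) v) \<le> C * r ^ j * norm v"
proof -
  let ?cA = "map_matrix complex_of_real A"
  let ?cv = "\<lambda>v::real^'m. (\<chi> i. complex_of_real (v $ i)) :: complex^'m"
  have cA: "?cA *v ?cv v = ?cv (A *v v)" for v
    by (simp add: vec_eq_iff map_matrix_def matrix_vector_mult_def)
  have cv: "?cv (u + e *\<^sub>R w) = ?cv u + e *\<^sub>R ?cv w" for u w e
    by (simp add: vec_eq_iff complex_eq_iff)
  have "(euler_map ((*v) ?cA) e ^^ j) (?cv v) = ?cv ((euler_map ((*v) A) e ^^ j) v)" for e j v
  proof (induction j)
    case (Suc j)
    then show ?case
      by (simp only: funpow.simps o_apply euler_map_def cA cv)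
  qed simp
  moreover have "norm (?cv v) = norm v" for v
    by (simp add: norm_vec_def)
  ultimately have norm_eq: "norm ((euler_map ((*v) ?cA) e ^^ j) (?cv v)) = norm ((euler_map ((*v) A) e ^^ j) v)" for e j v
    by simp
  have "\<exists>e0>0. \<forall>e. 0 < e \<and> e \<le> e0 \<longrightarrow>
    geometric_decay (\<lambda>j. (euler_map ((*v) A) e ^^ j) v)" for v
  proof -
    obtain p where "p \<noteq> 0" "poly_apply p ?cA (?cv v) = 0" by (rule annihilating_polynomial)
    moreover have "\<And>c v. v \<noteq> 0 \<Longrightarrow> ?cA *v v = c *s v \<Longrightarrow> Re c < 0"
      using assms unfolding hurwitz_def by blast
    ultimately show ?thesis
      using euler_map_decay[of ?cA p "?cv v"] unfolding geometric_decay_def norm_eq by blast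
  qed
  then obtain E where E: "\<And>v. E v > 0" "\<And>v e. 0 < e \<Longrightarrow> e \<le> E v \<Longrightarrow>
    geometric_decay (\<lambda>j. (euler_map ((*v) A) e ^^ j) v)"
    by metis
  define e where "e = Min (E ` Basis)"
  have e: "e > 0" "\<And>b. b \<in> Basis \<Longrightarrow> e \<le> E b" using E(1) by (auto simp: e_def)
  then have "\<forall>b\<in>Basis. geometric_decay (\<lambda>j. (euler_map ((*v) A) e ^^ j) b)"
    using E(2) by blast
  then have "\<forall>b\<in>Basis. \<exists>C r. 0 \<le> r \<and> r < 1 \<and> (\<forall>j. norm ((euler_map ((*v) A) e ^^ j) b) \<le> C * r ^ j)"
    unfolding geometric_decay_def .
  then obtain C r where Cr: "\<And>b. b \<in> Basis \<Longrightarrow> 0 \<le> r b \<and> r b < 1"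
    "\<And>b j. b \<in> Basis \<Longrightarrow> norm ((euler_map ((*v) A) e ^^ j) b) \<le> C b * r b ^ j"
    by metis
  \<comment> \<open>The entry 1/2 keeps the common rate positive, because the adapted norm divides
    by its powers.\<close>
  define s where "s = Max (insert (1/2) (r ` Basis))"
  have s_ge: "x \<le> s" if "x \<in> insert (1/2) (r ` Basis)" for x
    unfolding s_def using that by (intro Max_ge) auto
  have "s < 1" unfolding s_def using Cr(1) by (subst Max_less_iff) auto
  with s_ge[of "1/2"] s_ge have s: "0 < s" "s < 1" "\<And>b. b \<in> Basis \<Longrightarrow> r b \<le> s" by auto
  have C0: "C b \<ge> 0" if "b \<in> Basis" for b
    using order_trans[OF norm_ge_zero Cr(2)[OF that, of 0]] by simp
  have lin: "linear (euler_map ((*v) A) e ^^ j)" for j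
  proof (induction j)
    case (Suc j)
    have "linear (euler_map ((*v) A) e)"
      unfolding euler_map_def
      by (intro linear_compose_add linear_compose_scale_right matrix_vector_mul_linear linear_ident)
    then show ?case unfolding funpow.simps by (intro linear_compose Suc.IH)
  qed (simp add: id_def linear_ident)
  have "norm ((euler_map ((*v) A) e ^^ j) v) \<le> sum C Basis * s ^ j * norm v" for j v
  proof -
    have "(euler_map ((*v) A) e ^^ j) v = (euler_map ((*v) A) e ^^ j) (\<Sum>b\<in>Basis. (v \<bullet> b) *\<^sub>R b)"
      by (simp add: euclidean_representation)
    also have "\<dots> = (\<Sum>b\<in>Basis. (v \<bullet> b) *\<^sub>R (euler_map ((*v) A) e ^^ j) b)"
      by (simp add: linear_sum[OF lin] linear_cmul[OF lin])
    also have "norm \<dots> \<le> (\<Sum>b\<in>Basis. norm v * (C b * s ^ j))"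
    proof (rule sum_norm_le)
      fix b :: "real^'m" assume b: "b \<in> Basis"
      have "norm ((euler_map ((*v) A) e ^^ j) b) \<le> C b * r b ^ j" using Cr b by blast
      also have "\<dots> \<le> C b * s ^ j" using Cr(1) s b C0 by (intro mult_left_mono power_mono) auto
      finally show "norm ((v \<bullet> b) *\<^sub>R (euler_map ((*v) A) e ^^ j) b) \<le> norm v * (C b * s ^ j)"
        using Basis_le_norm[OF b, of v] by (simp add: mult_mono)
    qed
    finally show ?thesis by (simp add: sum_distrib_left sum_distrib_right mult_ac)
  qed
  then show ?thesis using that e(1) s by blast
qed

text \<open>The norm is \<open>sup\<^sub>j r\<^sup>-\<^sup>j \<parallel>M\<^sup>j v\<parallel>\<close> for \<open>M = I + e0 A\<close>; smaller steps are convex combinations of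
  \<open>I\<close> and \<open>M\<close>.\<close>

lemma hurwitz_adapted_norm:
  fixes A :: "real^'m^'m"
  assumes "hurwitz A"
  obtains N c e0 a where "equivalent_norm N c" "e0 > 0" "a > 0"
    "\<And>e v. 0 < e \<Longrightarrow> e \<le> e0 \<Longrightarrow> N (v + e *\<^sub>R (A *v v)) \<le> (1 - e * a) * N v"
proof -
  obtain e0 r C where e0: "e0 > 0" and r: "0 < r" "r < 1"
    and "\<forall>j v. norm ((euler_map ((*v) A) e0 ^^ j) v) \<le> C * r ^ j * norm v"
    by (rule hurwitz_euler_map_decay[OF assms])
  then have C: "norm ((euler_map ((*v) A) e0 ^^ j) v) \<le> C * r ^ j * norm v" for j v
    by blast
  let ?M = "euler_map ((*v) A) e0"
  have add: "(?M ^^ j) (u + v) = (?M ^^ j) u + (?M ^^ j) v" for j u v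
    by (induction j) (auto simp: euler_map_def matrix_vector_right_distrib algebra_simps)
  have scale: "(?M ^^ j) (c *\<^sub>R v) = c *\<^sub>R (?M ^^ j) v" for j c v
    by (induction j) (auto simp: euler_map_def linear_cmul[OF matrix_vector_mul_linear] algebra_simps)
  define N where "N v = (SUP j. norm ((?M ^^ j) v) / r ^ j)" for v
  have bound: "norm ((?M ^^ j) v) / r ^ j \<le> C * norm v" for j v
    using C[of j v] r by (simp add: field_simps)
  have bdd: "bdd_above (range (\<lambda>j. norm ((?M ^^ j) v) / r ^ j))" for v
    by (rule bdd_aboveI2[OF bound])
  have upper: "norm ((?M ^^ j) v) / r ^ j \<le> N v" for j v
    unfolding N_def by (intro cSUP_upper bdd) simp
  have lower: "N v \<le> m" if "\<And>j. norm ((?M ^^ j) v) / r ^ j \<le> m" for v m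
    unfolding N_def using that by (intro cSUP_least) auto
  have N_add: "N (u + v) \<le> N u + N v" for u v
  proof (rule lower)
    fix j
    have "norm ((?M ^^ j) (u + v)) / r ^ j \<le> (norm ((?M ^^ j) u) + norm ((?M ^^ j) v)) / r ^ j"
      using r by (intro divide_right_mono) (auto simp: add norm_triangle_ineq)
    then show "norm ((?M ^^ j) (u + v)) / r ^ j \<le> N u + N v"
      using upper[of j u] upper[of j v] by (simp add: add_divide_distrib)
  qed
  have scale_le: "N (c *\<^sub>R v) \<le> \<bar>c\<bar> * N v" for c v
  proof (rule lower)
    show "norm ((?M ^^ j) (c *\<^sub>R v)) / r ^ j \<le> \<bar>c\<bar> * N v" for j
      using mult_left_mono[OF upper[of j v], of "\<bar>c\<bar>"] by (simp add: scale)
  qed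
  have N_scale: "N (c *\<^sub>R v) = \<bar>c\<bar> * N v" for c v
  proof (cases "c = 0")
    case True
    have "N 0 = 0" using scale_le[of 0 0] upper[of 0 0] by simp
    then show ?thesis using True by simp
  next
    case False
    have "\<bar>c\<bar> * N v \<le> N (c *\<^sub>R v)"
      using scale_le[of "inverse c" "c *\<^sub>R v"] False by (simp add: field_simps)
    then show ?thesis using scale_le[of c v] by simp
  qed
  have norm: "equivalent_norm N C"
    using upper[of 0] by unfold_locales (auto simp: N_add N_scale intro: lower bound)
  \<comment> \<open>Applying \<open>?M\<close> shifts the index of the supremum by one, which
    releases a factor \<open>r\<close>.\<close>
  have M: "N (?M v) \<le> r * N v" for v
  proof (rule lower)
    show "norm ((?M ^^ j) (?M v)) / r ^ j \<le> r * N v" for j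
      using mult_left_mono[OF upper[of "Suc j" v], of r] r
      by (simp add: funpow_swap1[symmetric] field_simps)
  qed
  \<comment> \<open>The rate is (1 - r) / e0, because the convex combination contracts by 1 - e/e0 +
    r e/e0.\<close>
  have "N (v + e *\<^sub>R (A *v v)) \<le> (1 - e * ((1 - r) / e0)) * N v" if e: "0 < e" "e \<le> e0" for e v
  proof -
    have "v + e *\<^sub>R (A *v v) = (1 - e / e0) *\<^sub>R v + (e / e0) *\<^sub>R ?M v"
      using e0 by (simp add: euler_map_def algebra_simps)
    then have "N (v + e *\<^sub>R (A *v v)) \<le> N ((1 - e / e0) *\<^sub>R v) + N ((e / e0) *\<^sub>R ?M v)"
      using N_add by metis
    also have "\<dots> \<le> (1 - e / e0) * N v + (e / e0) * (r * N v)"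
      using e e0 M[of v] by (simp add: N_scale divide_right_mono mult_left_mono)
    finally show ?thesis using e0 by (simp add: field_simps)
  qed
  then show ?thesis using that[OF norm e0, of "(1 - r) / e0"] r e0 by simp
qed

section \<open>Smooth functions and global extensions\<close>

lemma C_k_SucD: "C_k (Suc k) F \<Longrightarrow> C_k k F"
proof (induction k arbitrary: F)
  case 0
  then show ?case
    by (auto intro!: differentiable_imp_continuous_on simp: differentiable_on_def
        intro: differentiable_at_withinI)
next
  case (Suc k)
  have *: "(\<forall>x. F differentiable (at x)) \<and> (\<forall>v. C_k (Suc k) (\<lambda>x. frechet_derivative F (at x) v))"
    using Suc.prems by (rule C_k.simps(2)[THEN iffD1])
  then have "\<forall>v. C_k k (\<lambda>x. frechet_derivative F (at x) v)" using Suc.IH by blast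
  with * show ?case unfolding C_k.simps(2) by blast
qed

lemma C_k_has_derivative: "C_k (Suc k) F \<Longrightarrow> (F has_derivative frechet_derivative F (at x)) (at x)"
  using frechet_derivative_works by (metis C_k.simps(2))

lemma C_k_SucI:
  assumes "\<And>x. (F has_derivative F' x) (at x)" "\<And>v. C_k k (\<lambda>x. F' x v)"
  shows "C_k (Suc k) F"
proof -
  have "frechet_derivative F (at x) = F' x" for x
    using assms(1) by (rule frechet_derivative_at[symmetric])
  moreover have "F differentiable (at x)" for x using assms(1) by (rule differentiableI)
  ultimately show ?thesis using assms(2) by simp
qed

lemma C_k_const: "C_k k (\<lambda>x. c)"
proof (induction k arbitrary: c)
  case (Suc k)
  show ?case by (rule C_k_SucI[where F' = "\<lambda>x v. 0"]) (auto intro: Suc)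
qed simp

lemma C_k_add:
  assumes "C_k k F" "C_k k G"
  shows "C_k k (\<lambda>x. F x + G x)"
  using assms
proof (induction k arbitrary: F G)
  case 0
  then show ?case by (simp add: continuous_on_add)
next
  case (Suc k)
  show ?case
  proof (rule C_k_SucI)
    show "((\<lambda>x. F x + G x) has_derivative
        (\<lambda>v. frechet_derivative F (at x) v + frechet_derivative G (at x) v)) (at x)" for x
      using Suc.prems by (intro has_derivative_add C_k_has_derivative)
    show "C_k k (\<lambda>x. frechet_derivative F (at x) v + frechet_derivative G (at x) v)" for v
      using Suc.prems by (intro Suc.IH) auto
  qed
qed

lemma C_k_sum: "(\<And>i. i \<in> I \<Longrightarrow> C_k k (F i)) \<Longrightarrow> C_k k (\<lambda>x. \<Sum>i\<in>I. F i x)"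
  by (induction I rule: infinite_finite_induct) (auto intro: C_k_add C_k_const)

lemma C_k_linear:
  assumes T: "bounded_linear T" and "C_k k F"
  shows "C_k k (\<lambda>x. T (F x))"
  using assms(2)
proof (induction k arbitrary: F)
  case 0
  then show ?case using bounded_linear.continuous_on[OF T] by simp
next
  case (Suc k)
  show ?case
  proof (rule C_k_SucI)
    show "((\<lambda>x. T (F x)) has_derivative (\<lambda>v. T (frechet_derivative F (at x) v))) (at x)" for x
      using Suc.prems by (intro bounded_linear.has_derivative[OF T] C_k_has_derivative)
    show "C_k k (\<lambda>x. T (frechet_derivative F (at x) v))" for v
      using Suc.prems by (intro Suc.IH) auto
  qed
qed

lemma C_k_scaleR:
  fixes F :: "'a::real_normed_vector \<Rightarrow> real" and G :: "'a \<Rightarrow> 'b::real_normed_vector"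
  assumes "C_k k F" "C_k k G"
  shows "C_k k (\<lambda>x. F x *\<^sub>R G x)"
  using assms
proof (induction k arbitrary: F G)
  case 0
  then show ?case by (simp add: continuous_on_scaleR)
next
  case (Suc k)
  show ?case
  proof (rule C_k_SucI)
    show "((\<lambda>x. F x *\<^sub>R G x) has_derivative
        (\<lambda>v. F x *\<^sub>R frechet_derivative G (at x) v + frechet_derivative F (at x) v *\<^sub>R G x)) (at x)" for x
      using Suc.prems by (intro has_derivative_scaleR C_k_has_derivative)
    show "C_k k (\<lambda>x. F x *\<^sub>R frechet_derivative G (at x) v + frechet_derivative F (at x) v *\<^sub>R G x)" for v
      using Suc.prems by (intro C_k_add Suc.IH) (auto intro: C_k_SucD)
  qed
qed

lemma smooth_has_derivative: "smooth F \<Longrightarrow> (F has_derivative frechet_derivative F (at x)) (at x)"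
  unfolding smooth_def by (blast intro: C_k_has_derivative)

lemma smooth_frechet_derivative: "smooth F \<Longrightarrow> smooth (\<lambda>x. frechet_derivative F (at x) v)"
  unfolding smooth_def by (metis C_k.simps(2))

lemma smooth_continuous_on: "smooth F \<Longrightarrow> continuous_on UNIV F"
  unfolding smooth_def by (metis C_k.simps(1))

lemma smooth_linear: "bounded_linear T \<Longrightarrow> smooth F \<Longrightarrow> smooth (\<lambda>x. T (F x))"
  unfolding smooth_def by (blast intro: C_k_linear)

lemma smooth_sum: "(\<And>i. i \<in> I \<Longrightarrow> smooth (F i)) \<Longrightarrow> smooth (\<lambda>x. \<Sum>i\<in>I. F i x)"
  unfolding smooth_def by (blast intro: C_k_sum)

lemma smooth_scaleR:
  fixes F :: "'a::real_normed_vector \<Rightarrow> real" and G :: "'a \<Rightarrow> 'b::real_normed_vector"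
  shows "smooth F \<Longrightarrow> smooth G \<Longrightarrow> smooth (\<lambda>x. F x *\<^sub>R G x)"
  unfolding smooth_def by (blast intro: C_k_scaleR)

lemma smooth_jacobian:
  fixes F :: "real^'n \<Rightarrow> real^'p"
  assumes "smooth F"
  shows "(F has_derivative (*v) (jacobian F (at x))) (at x)"
  using smooth_has_derivative[OF assms] by (auto simp flip: jacobian_works intro: differentiableI)

text \<open>\<open>C_k\<close> controls derivatives in fixed directions, whereas the direction
  \<open>f x\<close> varies. Expanding it in the standard basis gives a sum of products of smooth
  functions.\<close>

lemma smooth_lie_derivative:
  fixes f :: "real^'n \<Rightarrow> real^'n" and h :: "real^'n \<Rightarrow> real^'p"
  assumes f: "smooth f" and h: "smooth h"
  shows "smooth (lie_derivative f j h)"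
proof (induction j)
  case (Suc j)
  let ?L = "lie_derivative f j h"
  have "lie_derivative f (Suc j) h x = (\<Sum>i\<in>UNIV. (f x $ i) *\<^sub>R frechet_derivative ?L (at x) (axis i 1))" for x
  proof -
    have lin: "linear (frechet_derivative ?L (at x))"
      using smooth_has_derivative[OF Suc] by (rule has_derivative_linear)
    have "lie_derivative f (Suc j) h x = frechet_derivative ?L (at x) (f x)"
      using has_derivative_unique[OF smooth_jacobian[OF Suc] smooth_has_derivative[OF Suc]]
      by (metis lie_derivative.simps(2))
    also have "f x = (\<Sum>i\<in>UNIV. (f x $ i) *\<^sub>R axis i 1)"
      using basis_expansion[of "f x"] by (simp add: scalar_mult_eq_scaleR)
    finally show ?thesis
      by (simp add: linear_sum[OF lin] linear_cmul[OF lin])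
  qed
  then have "lie_derivative f (Suc j) h
      = (\<lambda>x. \<Sum>i\<in>UNIV. (f x $ i) *\<^sub>R frechet_derivative ?L (at x) (axis i 1))" by blast
  moreover have "smooth (\<lambda>x. f x $ i)" for i
    by (rule smooth_linear[OF bounded_linear_vec_nth f])
  ultimately show ?case
    by (simp only: smooth_sum smooth_scaleR smooth_frechet_derivative[OF Suc])
qed (use h in simp)

text \<open>Mean value inequality along the segment for \<open>u\<close> minus the linear map
  \<open>D x\<close>, whose derivative at \<open>z\<close> is \<open>D z - D x\<close>.\<close>

lemma C11I:
  fixes u :: "'a::real_normed_vector \<Rightarrow> 'b::real_normed_vector" and D :: "'a \<Rightarrow> 'a \<Rightarrow>\<^sub>L 'b"
  assumes u: "\<And>x. (u has_derivative D x) (at x)"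
    and L: "\<And>x w. norm (D x w) \<le> L * norm w"
    and M: "\<And>x y w. norm (D x w - D y w) \<le> M * norm (x - y) * norm w" "M \<ge> 0"
  shows "C11 norm L M u D"
proof -
  have "norm (u y - u x - D x (y - x)) \<le> M * (norm (y - x))\<^sup>2" for x y
  proof -
    have "norm ((u y - D x y) - (u x - D x x)) \<le> (M * norm (y - x)) * norm (y - x)"
    proof (rule differentiable_bound[of "closed_segment x y"])
      fix z assume z: "z \<in> closed_segment x y"
      show "((\<lambda>z. u z - D x z) has_derivative (\<lambda>w. D z w - D x w)) (at z within closed_segment x y)"
        by (intro has_derivative_diff has_derivative_at_withinI[OF u]
            bounded_linear_imp_has_derivative blinfun.bounded_linear_right)
      have "norm (z - x) \<le> norm (y - x)"
        using segment_bound(1)[OF z] by (simp add: norm_minus_commute)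
      then have "norm (D z w - D x w) \<le> M * norm (y - x) * norm w" for w
        using M(1)[of z w x] M(2) by (meson mult_left_mono mult_right_mono norm_ge_zero order_trans)
      then show "onorm (\<lambda>w. D z w - D x w) \<le> M * norm (y - x)"
        using M(2) by (intro onorm_bound) auto
    qed auto
    then show ?thesis by (simp add: blinfun.diff_right algebra_simps power2_eq_square)
  qed
  then show ?thesis using L by (simp add: C11_def)
qed

text \<open>Smoothness gives continuity of the derivative in each fixed direction; summing the
  resulting bounds over a basis yields one operator bound on \<open>K\<close>.\<close>

lemma smooth_derivative_bounded:
  fixes F :: "'a::euclidean_space \<Rightarrow> 'b::real_normed_vector"
  assumes F: "smooth F" and K: "compact K"
  obtains L where "L \<ge> 0" "\<And>x w. x \<in> K \<Longrightarrow> norm (frechet_derivative F (at x) w) \<le> L * norm w"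
proof -
  have "\<exists>B. \<forall>x\<in>K. norm (frechet_derivative F (at x) b) \<le> B" for b
  proof -
    have "continuous_on K (\<lambda>x. frechet_derivative F (at x) b)"
      using smooth_continuous_on[OF smooth_frechet_derivative[OF F]] continuous_on_subset by blast
    then have "bounded ((\<lambda>x. frechet_derivative F (at x) b) ` K)"
      using K by (intro compact_imp_bounded compact_continuous_image)
    then show ?thesis by (auto simp: bounded_iff)
  qed
  then obtain B where B: "\<And>b x. x \<in> K \<Longrightarrow> norm (frechet_derivative F (at x) b) \<le> B b" by metis
  define L where "L = (\<Sum>b\<in>Basis. max 0 (B b))"
  have "norm (frechet_derivative F (at x) w) \<le> L * norm w" if "x \<in> K" for x w
  proof -
    have lin: "linear (frechet_derivative F (at x))"
      using smooth_has_derivative[OF F] by (rule has_derivative_linear)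
    have "frechet_derivative F (at x) w = frechet_derivative F (at x) (\<Sum>b\<in>Basis. (w \<bullet> b) *\<^sub>R b)"
      by (simp add: euclidean_representation)
    also have "\<dots> = (\<Sum>b\<in>Basis. (w \<bullet> b) *\<^sub>R frechet_derivative F (at x) b)"
      by (simp add: linear_sum[OF lin] linear_cmul[OF lin])
    also have "norm \<dots> \<le> (\<Sum>b\<in>Basis. norm w * max 0 (B b))"
    proof (rule sum_norm_le)
      fix b :: 'a assume b: "b \<in> Basis"
      have "\<bar>w \<bullet> b\<bar> * norm (frechet_derivative F (at x) b) \<le> norm w * max 0 (B b)"
        using B[OF that, of b] Basis_le_norm[OF b, of w] by (intro mult_mono) auto
      then show "norm ((w \<bullet> b) *\<^sub>R frechet_derivative F (at x) b) \<le> norm w * max 0 (B b)" by simp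
    qed
    finally show ?thesis by (simp add: L_def sum_distrib_left mult.commute)
  qed
  moreover have "L \<ge> 0" by (auto simp: L_def intro: sum_nonneg)
  ultimately show ?thesis using that by blast
qed

lemma smooth_lipschitz_on_compact_convex:
  fixes F :: "'a::euclidean_space \<Rightarrow> 'b::real_normed_vector"
  assumes F: "smooth F" and K: "compact K" "convex K"
  obtains L where "L \<ge> 0" "\<And>x y. x \<in> K \<Longrightarrow> y \<in> K \<Longrightarrow> norm (F x - F y) \<le> L * norm (x - y)"
proof -
  obtain L where L: "L \<ge> 0" "\<And>x w. x \<in> K \<Longrightarrow> norm (frechet_derivative F (at x) w) \<le> L * norm w"
    using smooth_derivative_bounded[OF F K(1)] by blast
  have "norm (F x - F y) \<le> L * norm (x - y)" if "x \<in> K" "y \<in> K" for x y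
  proof (rule differentiable_bound[OF K(2) _ _ that])
    show "(F has_derivative frechet_derivative F (at z)) (at z within K)" for z
      using smooth_has_derivative[OF F] by (rule has_derivative_at_withinI)
    show "onorm (frechet_derivative F (at z)) \<le> L" if "z \<in> K" for z
      using L that by (intro onorm_bound) auto
  qed
  then show ?thesis using that L(1) by blast
qed

lemma smooth_derivative_lipschitz:
  fixes F :: "'a::euclidean_space \<Rightarrow> 'b::real_normed_vector"
  assumes F: "smooth F" and K: "compact K" "convex K"
  obtains M where "M \<ge> 0" "\<And>x y w. x \<in> K \<Longrightarrow> y \<in> K \<Longrightarrow>
    norm (frechet_derivative F (at x) w - frechet_derivative F (at y) w) \<le> M * norm (x - y) * norm w"
proof -
  let ?D = "\<lambda>x. frechet_derivative F (at x)"
  have "\<exists>L. L \<ge> 0 \<and> (\<forall>x\<in>K. \<forall>y\<in>K. norm (?D x b - ?D y b) \<le> L * norm (x - y))" for b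
    by (rule smooth_lipschitz_on_compact_convex[OF smooth_frechet_derivative[OF F, of b] K]) blast
  then obtain L where L: "\<And>b. L b \<ge> 0"
    "\<And>b x y. x \<in> K \<Longrightarrow> y \<in> K \<Longrightarrow> norm (?D x b - ?D y b) \<le> L b * norm (x - y)" by metis
  have "norm (?D x w - ?D y w) \<le> sum L Basis * norm (x - y) * norm w" if "x \<in> K" "y \<in> K" for x y w
  proof -
    have lin: "linear (?D x)" for x
      using smooth_has_derivative[OF F] by (rule has_derivative_linear)
    have lin: "linear (\<lambda>w. ?D x w - ?D y w)" by (intro linear_compose_sub lin)
    have "?D x w - ?D y w = (\<lambda>w. ?D x w - ?D y w) (\<Sum>b\<in>Basis. (w \<bullet> b) *\<^sub>R b)"
      by (simp add: euclidean_representation)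
    also have "\<dots> = (\<Sum>b\<in>Basis. (w \<bullet> b) *\<^sub>R (?D x b - ?D y b))"
      by (simp only: linear_sum[OF lin] linear_cmul[OF lin])
    also have "norm \<dots> \<le> (\<Sum>b\<in>Basis. norm w * (L b * norm (x - y)))"
    proof (rule sum_norm_le)
      fix b :: 'a assume b: "b \<in> Basis"
      have "\<bar>w \<bullet> b\<bar> * norm (?D x b - ?D y b) \<le> norm w * (L b * norm (x - y))"
        using L(2)[OF that, of b] Basis_le_norm[OF b, of w] by (intro mult_mono) auto
      then show "norm ((w \<bullet> b) *\<^sub>R (?D x b - ?D y b)) \<le> norm w * (L b * norm (x - y))" by simp
    qed
    finally show ?thesis by (simp add: sum_distrib_left sum_distrib_right mult_ac)
  qed
  moreover have "sum L Basis \<ge> 0" using L(1) by (intro sum_nonneg) auto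
  ultimately show ?thesis using that by blast
qed


section \<open>A bounded saturation of the real line with Lipschitz derivative\<close>

definition arctan_defect :: "real \<Rightarrow> real" where
  "arctan_defect u = max 0 u - arctan (max 0 u)"

text \<open>For positive u this is u^2 / (1 + u^2): it vanishes at 0, stays below 1 and is
  Lipschitz. Subtracting the defect from the identity thus bends it into arctan and keeps the
  derivative Lipschitz.\<close>

definition arctan_defect' :: "real \<Rightarrow> real" where
  "arctan_defect' u = 1 - 1 / (1 + (max 0 u)\<^sup>2)"

lemma arctan_defect_derivative:
  "(arctan_defect has_real_derivative arctan_defect' u) (at u)"
proof -
  have left: "(arctan_defect has_real_derivative arctan_defect' u) (at u within {..0})" if "u \<le> 0"
  proof (rule has_field_derivative_transform_within[where d = 1])
    show "((\<lambda>x. 0) has_real_derivative arctan_defect' u) (at u within {..0})"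
      using that by (simp add: arctan_defect'_def max_def)
  qed (use that in \<open>auto simp: arctan_defect_def max_def\<close>)
  have right: "(arctan_defect has_real_derivative arctan_defect' u) (at u within {0..})" if "0 \<le> u"
  proof (rule has_field_derivative_transform_within[where d = 1])
    have "((\<lambda>x. x - arctan x) has_real_derivative 1 - inverse (1 + u\<^sup>2)) (at u within {0..})"
      by (intro DERIV_diff DERIV_ident has_field_derivative_at_within[OF DERIV_arctan])
    then show "((\<lambda>x. x - arctan x) has_real_derivative arctan_defect' u) (at u within {0..})"
      using that by (simp add: arctan_defect'_def divide_inverse)
  qed (use that in \<open>auto simp: arctan_defect_def\<close>)
  consider "u < 0" | "u = 0" | "u > 0" by linarith
  then show ?thesis
  proof cases
    case 1
    then have "at u within {..0} = at u" by (intro at_within_interior) simp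
    then show ?thesis using left 1 by simp
  next
    case 2
    have "((\<lambda>y. (arctan_defect y - arctan_defect 0) / (y - 0)) \<longlongrightarrow> arctan_defect' 0)
        (sup (at 0 within {..0}) (at 0 within {0..}))"
      using left right 2 unfolding has_field_derivative_iff by (intro filterlim_sup) auto
    moreover have "{..0} \<union> {0..} = (UNIV :: real set)" by auto
    ultimately show ?thesis
      using 2 by (simp add: has_field_derivative_iff at_within_union[symmetric])
  next
    case 3
    then have "at u within {0..} = at u" by (intro at_within_interior) simp
    then show ?thesis using right 3 by simp
  qed
qed

lemma arctan_defect'_bounds: "0 \<le> arctan_defect' u" "arctan_defect' u \<le> 1"
  by (simp_all add: arctan_defect'_def divide_le_eq_1 add_pos_nonneg)

lemma arctan_defect'_lipschitz: "\<bar>arctan_defect' u - arctan_defect' v\<bar> \<le> \<bar>u - v\<bar>"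
proof -
  define m n where "m = max 0 u" and "n = max 0 v"
  have mn: "0 \<le> m" "0 \<le> n" "\<bar>m - n\<bar> \<le> \<bar>u - v\<bar>" by (auto simp: m_def n_def)
  have pos: "0 < 1 + m\<^sup>2" "0 < 1 + n\<^sup>2" by (auto intro: add_pos_nonneg)
  \<comment> \<open>Twice the difference of the two sides is the sum of squares below.\<close>
  have "m + n \<le> (1 + m\<^sup>2) * (1 + n\<^sup>2)"
  proof -
    have "0 \<le> (m - 1)\<^sup>2 + (n - 1)\<^sup>2 + 2 * (m\<^sup>2 * n\<^sup>2) + m\<^sup>2 + n\<^sup>2" by simp
    then show ?thesis by (simp add: power2_eq_square algebra_simps)
  qed
  then have q: "(m + n) / ((1 + m\<^sup>2) * (1 + n\<^sup>2)) \<le> 1" using pos by simp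
  have "arctan_defect' u - arctan_defect' v = (m - n) * ((m + n) / ((1 + m\<^sup>2) * (1 + n\<^sup>2)))"
    using pos by (simp add: arctan_defect'_def m_def[symmetric] n_def[symmetric] field_simps power2_eq_square)
  then have "\<bar>arctan_defect' u - arctan_defect' v\<bar> = \<bar>m - n\<bar> * ((m + n) / ((1 + m\<^sup>2) * (1 + n\<^sup>2)))"
    using mn pos by (simp add: abs_mult)
  also have "\<dots> \<le> \<bar>m - n\<bar>" using mult_left_mono[OF q, of "\<bar>m - n\<bar>"] by simp
  finally show ?thesis using mn by linarith
qed

lemma arctan_defect_nonpos: "u \<le> 0 \<Longrightarrow> arctan_defect u = 0"
  by (simp add: arctan_defect_def max_def)

lemma arctan_defect'_nonpos: "u \<le> 0 \<Longrightarrow> arctan_defect' u = 0"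
  by (simp add: arctan_defect'_def max_def)

text \<open>The identity on \<open>[-R, R]\<close>, continued by \<open>\<plusminus>(R + arctan (\<bar>s\<bar> - R))\<close>.\<close>

definition saturation :: "real \<Rightarrow> real \<Rightarrow> real" where
  "saturation R s = s - arctan_defect (s - R) + arctan_defect (- s - R)"

definition saturation' :: "real \<Rightarrow> real \<Rightarrow> real" where
  "saturation' R s = 1 - arctan_defect' (s - R) - arctan_defect' (- s - R)"

lemma saturation_derivative: "(saturation R has_real_derivative saturation' R s) (at s)"
proof -
  have "((\<lambda>s. arctan_defect (s - R)) has_real_derivative arctan_defect' (s - R) * 1) (at s)"
    by (rule DERIV_chain2[OF arctan_defect_derivative]) (auto intro!: derivative_eq_intros)
  moreover have "((\<lambda>s. arctan_defect (- s - R)) has_real_derivative arctan_defect' (- s - R) * (- 1)) (at s)"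
    by (rule DERIV_chain2[OF arctan_defect_derivative]) (auto intro!: derivative_eq_intros)
  ultimately have "((\<lambda>s. s - arctan_defect (s - R) + arctan_defect (- s - R)) has_real_derivative
      1 - arctan_defect' (s - R) * 1 + arctan_defect' (- s - R) * (- 1)) (at s)"
    by (intro DERIV_add DERIV_diff DERIV_ident)
  then show ?thesis by (simp add: saturation_def[abs_def] saturation'_def)
qed

lemma saturation_id: "\<bar>s\<bar> \<le> R \<Longrightarrow> saturation R s = s"
  by (simp add: saturation_def arctan_defect_nonpos)

lemma saturation_bounded:
  assumes "R \<ge> 0"
  shows "\<bar>saturation R s\<bar> \<le> R + 2"
proof -
  \<comment> \<open>The difference is \<open>arctan u\<close>, which is below pi/2 and hence below
    2.\<close>
  have bound: "\<bar>u - arctan_defect u\<bar> \<le> 2" if "u \<ge> 0" for u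
    using arctan_bounded[of u] pi_less_4 that by (simp add: arctan_defect_def abs_le_iff)
  consider "\<bar>s\<bar> \<le> R" | "s \<ge> R" | "- s \<ge> R" by linarith
  then show ?thesis
  proof cases
    case 1
    then show ?thesis by (simp add: saturation_id)
  next
    case 2
    then have "saturation R s = R + ((s - R) - arctan_defect (s - R))"
      using assms by (simp add: saturation_def arctan_defect_nonpos)
    then show ?thesis using bound[of "s - R"] 2 assms by linarith
  next
    case 3
    then have "saturation R s = - R - ((- s - R) - arctan_defect (- s - R))"
      using assms by (simp add: saturation_def arctan_defect_nonpos)
    then show ?thesis using bound[of "- s - R"] 3 assms by linarith
  qed
qed

lemma saturation'_bounded:
  assumes "R \<ge> 0"
  shows "\<bar>saturation' R s\<bar> \<le> 1"
proof -
  have "arctan_defect' (s - R) = 0 \<or> arctan_defect' (- s - R) = 0"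
    using assms by (cases "s \<ge> 0") (auto simp: arctan_defect'_nonpos)
  then show ?thesis
    using arctan_defect'_bounds[of "s - R"] arctan_defect'_bounds[of "- s - R"]
    by (auto simp: saturation'_def)
qed

lemma saturation'_lipschitz: "\<bar>saturation' R s - saturation' R t\<bar> \<le> 2 * \<bar>s - t\<bar>"
proof -
  have "\<bar>arctan_defect' (s - R) - arctan_defect' (t - R)\<bar> \<le> \<bar>s - t\<bar>"
    using arctan_defect'_lipschitz[of "s - R" "t - R"] by simp
  moreover have "\<bar>arctan_defect' (- s - R) - arctan_defect' (- t - R)\<bar> \<le> \<bar>s - t\<bar>"
    using arctan_defect'_lipschitz[of "- s - R" "- t - R"] by (simp add: abs_minus_commute)
  ultimately show ?thesis
    using abs_triangle_ineq4[of "arctan_defect' (t - R) - arctan_defect' (s - R)"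
        "arctan_defect' (- s - R) - arctan_defect' (- t - R)"]
    by (simp add: saturation'_def abs_minus_commute algebra_simps)
qed

text \<open>Precomposing with the componentwise saturation makes all bounds global without changing the function on a
  given compact set.\<close>

lemma smooth_C11_extension:
  fixes F :: "real^'n \<Rightarrow> 'b::euclidean_space"
  assumes F: "smooth F" and X: "compact X"
  obtains G D L M B where "C11 norm L M G D" "L \<ge> 0" "M \<ge> 0" "\<And>x. x \<in> X \<Longrightarrow> G x = F x"
    "\<And>x. norm (G x) \<le> B"
proof -
  obtain R where R: "R \<ge> 0" "\<And>x. x \<in> X \<Longrightarrow> norm x \<le> R"
  proof -
    obtain R where "\<And>x. x \<in> X \<Longrightarrow> norm x \<le> R"
      using compact_imp_bounded[OF X] by (auto simp: bounded_iff)
    then show ?thesis using that[of "max 0 R"] by force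
  qed
  define \<rho> :: "real^'n \<Rightarrow> real^'n" where "\<rho> x = (\<chi> i. saturation R (x $ i))" for x
  define \<rho>' :: "real^'n \<Rightarrow> real^'n \<Rightarrow> real^'n" where "\<rho>' x w = (\<chi> i. saturation' R (x $ i) * w $ i)" for x w
  have \<rho>: "(\<rho> has_derivative \<rho>' x) (at x)" for x
    unfolding has_derivative_componentwise_within[of \<rho>]
  proof
    fix b :: "real^'n" assume "b \<in> Basis"
    then obtain i where b: "b = axis i 1" by (auto simp: Basis_vec_def)
    have "((\<lambda>x. saturation R (x $ i)) has_derivative (\<lambda>w. w $ i * saturation' R (x $ i))) (at x)"
      using has_derivative_compose[OF bounded_linear_imp_has_derivative[OF bounded_linear_vec_nth]
          saturation_derivative[unfolded has_field_derivative_def]] by (simp add: mult.commute)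
    then show "((\<lambda>x. \<rho> x \<bullet> b) has_derivative (\<lambda>w. \<rho>' x w \<bullet> b)) (at x)"
      by (simp add: b \<rho>_def \<rho>'_def inner_axis mult.commute)
  qed
  have \<rho>'_le: "norm (\<rho>' x w) \<le> norm w" for x w
  proof (rule norm_le_componentwise_cart)
    show "norm (\<rho>' x w $ i) \<le> norm (w $ i)" for i
      using saturation'_bounded[OF R(1), of "x $ i"] by (simp add: \<rho>'_def abs_mult mult_left_le_one_le)
  qed
  have \<rho>_lip: "norm (\<rho> x - \<rho> y) \<le> norm (x - y)" for x y
  proof -
    have "norm (\<rho> x - \<rho> y) \<le> 1 * norm (x - y)"
    proof (rule differentiable_bound[of UNIV])
      show "(\<rho> has_derivative \<rho>' z) (at z within UNIV)" for z using \<rho> by simp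
      show "onorm (\<rho>' z) \<le> 1" for z using \<rho>'_le by (intro onorm_bound) auto
    qed auto
    then show ?thesis by simp
  qed
  have \<rho>'_lip: "norm (\<rho>' x w - \<rho>' y w) \<le> 2 * norm (x - y) * norm w" for x y w
  proof -
    have "norm (\<rho>' x w - \<rho>' y w) \<le> norm ((2 * norm (x - y)) *\<^sub>R w)"
    proof (rule norm_le_componentwise_cart)
      fix i
      have "\<bar>saturation' R (x $ i) - saturation' R (y $ i)\<bar> \<le> 2 * norm (x - y)"
        using saturation'_lipschitz[of R "x $ i" "y $ i"] component_le_norm_cart[of "x - y" i] by simp
      then have "\<bar>saturation' R (x $ i) - saturation' R (y $ i)\<bar> * \<bar>w $ i\<bar> \<le> 2 * norm (x - y) * \<bar>w $ i\<bar>"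
        by (rule mult_right_mono) simp
      then show "norm ((\<rho>' x w - \<rho>' y w) $ i) \<le> norm (((2 * norm (x - y)) *\<^sub>R w) $ i)"
        by (simp add: \<rho>'_def abs_mult left_diff_distrib[symmetric])
    qed
    then show ?thesis by simp
  qed
  \<comment> \<open>The saturation maps everything into this cube, so bounds for \<open>F\<close> on
    a compact convex set become global bounds for the composition.\<close>
  define K :: "(real^'n) set" where "K = cbox (\<chi> i. - (R + 2)) (\<chi> i. R + 2)"
  have "- (R + 2) \<le> saturation R t" "saturation R t \<le> R + 2" for t
    using saturation_bounded[OF R(1), of t] by linarith+
  then have \<rho>_K: "\<rho> x \<in> K" for x
    by (simp add: K_def mem_box_cart \<rho>_def)
  have K: "compact K" "convex K" by (auto simp: K_def convex_box compact_cbox)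
  obtain L where L: "L \<ge> 0" "\<And>x w. x \<in> K \<Longrightarrow> norm (frechet_derivative F (at x) w) \<le> L * norm w"
    using smooth_derivative_bounded[OF F K(1)] by blast
  obtain M where M: "M \<ge> 0" "\<And>x y w. x \<in> K \<Longrightarrow> y \<in> K \<Longrightarrow>
    norm (frechet_derivative F (at x) w - frechet_derivative F (at y) w) \<le> M * norm (x - y) * norm w"
    using smooth_derivative_lipschitz[OF F K] by blast
  have "bounded (F ` K)"
    using K smooth_continuous_on[OF F] continuous_on_subset
    by (intro compact_imp_bounded compact_continuous_image) auto
  then obtain B where B: "\<And>x. x \<in> K \<Longrightarrow> norm (F x) \<le> B" by (auto simp: bounded_iff)
  define D where "D x = Blinfun (\<lambda>w. frechet_derivative F (at (\<rho> x)) (\<rho>' x w))" for x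
  have comp: "(F \<circ> \<rho> has_derivative (\<lambda>w. frechet_derivative F (at (\<rho> x)) (\<rho>' x w))) (at x)" for x
    using diff_chain_at[OF \<rho> smooth_has_derivative[OF F]] by (simp add: o_def)
  have D: "blinfun_apply (D x) w = frechet_derivative F (at (\<rho> x)) (\<rho>' x w)" for x w
    unfolding D_def by (subst bounded_linear_Blinfun_apply[OF has_derivative_bounded_linear[OF comp]]) simp
  have "C11 norm L (L * 2 + M) (F \<circ> \<rho>) D"
  proof (rule C11I)
    show "(F \<circ> \<rho> has_derivative D x) (at x)" for x
      using comp by (simp add: D[abs_def])
    show "norm (D x w) \<le> L * norm w" for x w
      using L(2)[OF \<rho>_K] \<rho>'_le L(1) unfolding D by (meson mult_left_mono order_trans)
    show "norm (D x w - D y w) \<le> (L * 2 + M) * norm (x - y) * norm w" for x y w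
    proof -
      let ?F = "\<lambda>x. frechet_derivative F (at x)"
      have lin: "linear (?F z)" for z using smooth_has_derivative[OF F] by (rule has_derivative_linear)
      \<comment> \<open>Product-rule split: the change of the inner derivative is bounded through
        \<open>L * 2\<close>, the change of the base point through \<open>M\<close>.\<close>
      have eq: "D x w - D y w = ?F (\<rho> x) (\<rho>' x w - \<rho>' y w) + (?F (\<rho> x) (\<rho>' y w) - ?F (\<rho> y) (\<rho>' y w))"
        by (simp add: D linear_diff[OF lin])
      have "norm (?F (\<rho> x) (\<rho>' x w - \<rho>' y w)) \<le> L * norm (\<rho>' x w - \<rho>' y w)" by (rule L(2)[OF \<rho>_K])
      also have "\<dots> \<le> L * (2 * norm (x - y) * norm w)" using \<rho>'_lip L(1) by (rule mult_left_mono)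
      finally have 1: "norm (?F (\<rho> x) (\<rho>' x w - \<rho>' y w)) \<le> L * (2 * norm (x - y) * norm w)" .
      have "norm (?F (\<rho> x) (\<rho>' y w) - ?F (\<rho> y) (\<rho>' y w)) \<le> M * norm (\<rho> x - \<rho> y) * norm (\<rho>' y w)"
        by (rule M(2)[OF \<rho>_K \<rho>_K])
      also have "\<dots> \<le> M * norm (x - y) * norm w"
        using M(1) \<rho>_lip \<rho>'_le by (intro mult_mono) auto
      finally have 2: "norm (?F (\<rho> x) (\<rho>' y w) - ?F (\<rho> y) (\<rho>' y w)) \<le> M * norm (x - y) * norm w" .
      have "norm (D x w - D y w) \<le> L * (2 * norm (x - y) * norm w) + M * norm (x - y) * norm w"
        unfolding eq by (rule norm_triangle_mono[OF 1 2])
      then show ?thesis by (simp add: algebra_simps)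
    qed
    show "0 \<le> L * 2 + M" using L M by simp
  qed
  moreover have "(F \<circ> \<rho>) x = F x" if "x \<in> X" for x
  proof -
    have "\<bar>x $ i\<bar> \<le> R" for i using component_le_norm_cart[of x i] R(2)[OF that] by linarith
    then have "\<rho> x = x" by (simp add: \<rho>_def saturation_id vec_eq_iff)
    then show ?thesis by simp
  qed
  moreover have "norm ((F \<circ> \<rho>) x) \<le> B" for x using B[OF \<rho>_K] by simp
  moreover have "0 \<le> L * 2 + M" using L M by simp
  ultimately show ?thesis using that L(1) by blast
qed

section \<open>Full rank, Kronecker products and controllability\<close>

text \<open>Injective or surjective is the form of full rank that visibly survives composition with
  a bijection, whichever dimension is smaller.\<close>

lemma full_rank_iff:
  fixes M :: "real^'n^'p"
  shows "rank M = min CARD('p) CARD('n) \<longleftrightarrow> inj ((*v) M) \<or> surj ((*v) M)"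
  using rank_bound[of M] full_rank_injective[of M] full_rank_surjective[of M] by (auto simp: min_def)

text \<open>Over the reals v . (M^T M v) = |M v|^2, so \<open>M\<close> and its Gram matrix have the
  same kernel. Full rank thereby becomes the nonvanishing of a continuous function.\<close>

lemma det_gram_nonzero_iff:
  fixes M :: "real^'n^'p"
  shows "det (transpose M ** M) \<noteq> 0 \<longleftrightarrow> inj ((*v) M)"
proof -
  have "(transpose M ** M) *v v = 0 \<longleftrightarrow> M *v v = 0" for v
  proof
    assume "(transpose M ** M) *v v = 0"
    then have "v \<bullet> (transpose M *v (M *v v)) = 0" by (simp add: matrix_vector_mul_assoc)
    then have "(M *v v) \<bullet> (M *v v) = 0" by (metis dot_lmul_matrix transpose_matrix_vector vector_transpose_matrix)
    then show "M *v v = 0" by simp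
  next
    assume "M *v v = 0"
    then show "(transpose M ** M) *v v = 0" by (simp flip: matrix_vector_mul_assoc)
  qed
  then have "inj ((*v) (transpose M ** M)) \<longleftrightarrow> inj ((*v) M)"
    by (simp add: linear_injective_0)
  then show ?thesis
    using invertible_det_nz[of "transpose M ** M"] invertible_left_inverse[of "transpose M ** M"]
      matrix_left_invertible_injective[of "transpose M ** M"] by simp
qed

lemma continuous_on_transpose_mult:
  "continuous_on UNIV (\<lambda>M :: real^'n^'p. transpose M ** M)"
  "continuous_on UNIV (\<lambda>M :: real^'n^'p. M ** transpose M)"
  unfolding matrix_matrix_mult_def transpose_def by (intro continuous_intros; simp)+

lemma continuous_on_det: "continuous_on UNIV (det :: real^'n^'n \<Rightarrow> real)"
  unfolding det_def[abs_def] by (intro continuous_intros)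

lemma open_full_rank: "open {M :: real^'n^'p. rank M = min CARD('p) CARD('n)}"
proof (cases "CARD('n) \<le> CARD('p)")
  case True
  have "{M :: real^'n^'p. rank M = min CARD('p) CARD('n)} = {M. det (transpose M ** M) \<noteq> 0}"
    using True by (simp add: min_absorb2 full_rank_injective det_gram_nonzero_iff)
  moreover have "continuous_on UNIV (\<lambda>M :: real^'n^'p. det (transpose M ** M))"
    by (rule continuous_on_compose2[OF continuous_on_det continuous_on_transpose_mult(1)]) auto
  ultimately show ?thesis by (simp add: open_Collect_neq)
next
  case False
  have "rank M = CARD('p) \<longleftrightarrow> det (M ** transpose M) \<noteq> 0" for M :: "real^'n^'p"
    using det_gram_nonzero_iff[of "transpose M"] full_rank_injective[of "transpose M"]
    by (simp add: rank_transpose)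
  then have "{M :: real^'n^'p. rank M = min CARD('p) CARD('n)} = {M. det (M ** transpose M) \<noteq> 0}"
    using False by (simp add: min_absorb1)
  moreover have "continuous_on UNIV (\<lambda>M :: real^'n^'p. det (M ** transpose M))"
    by (rule continuous_on_compose2[OF continuous_on_det continuous_on_transpose_mult(2)]) auto
  ultimately show ?thesis by (simp add: open_Collect_neq)
qed

lemma norm_matrix_le:
  fixes M :: "real^'n^'p"
  assumes "\<And>w. norm (M *v w) \<le> c * norm w"
  shows "norm M \<le> real CARD('p) * (real CARD('n) * c)"
proof -
  have "\<bar>M $ i $ j\<bar> \<le> c" for i j
  proof -
    have "M $ i $ j = (M *v axis j 1) $ i" by (simp add: matrix_vector_mul_component inner_axis)
    then have "\<bar>M $ i $ j\<bar> \<le> norm (M *v axis j 1)" by (simp add: component_le_norm_cart)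
    then show ?thesis using assms[of "axis j 1"] by simp
  qed
  then have "norm (M $ i) \<le> real CARD('n) * c" for i
    using norm_le_l1_cart[of "M $ i"] sum_bounded_above[of UNIV "\<lambda>j. \<bar>M $ i $ j\<bar>" c]
    by (meson order_trans UNIV_I)
  then have "(\<Sum>i\<in>UNIV. norm (M $ i)) \<le> real CARD('p) * (real CARD('n) * c)"
    by (intro sum_bounded_above)
  moreover have "norm M \<le> (\<Sum>i\<in>UNIV. norm (M $ i))"
    unfolding norm_vec_def by (rule L2_set_le_sum) simp
  ultimately show ?thesis by linarith
qed

lemma full_rank_perturbation:
  fixes C :: "(real^'n^'p) set"
  assumes "compact C" "\<And>M. M \<in> C \<Longrightarrow> rank M = min CARD('p) CARD('n)"
  obtains d where "d > 0"
    "\<forall>M\<in>C. \<forall>E. (\<forall>w. norm (E *v w) \<le> d * norm w) \<longrightarrow> rank (M + E) = min CARD('p) CARD('n)"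
proof (cases "C = {}")
  case False
  obtain e where e: "e > 0" "(\<Union>M\<in>C. ball M e) \<subseteq> {M. rank M = min CARD('p) CARD('n)}"
    using compact_subset_open_imp_ball_epsilon_subset[OF assms(1) open_full_rank] assms(2) by blast
  \<comment> \<open>With this choice \<open>norm_matrix_le\<close> turns the operator bound
    \<open>d\<close> into a bound e / 2 on \<open>norm E\<close>.\<close>
  define d where "d = e / (2 * (real CARD('p) * real CARD('n)))"
  have "d > 0" using e by (simp add: d_def)
  moreover have "rank (M + E) = min CARD('p) CARD('n)"
    if "M \<in> C" "\<And>w. norm (E *v w) \<le> d * norm w" for M E
  proof -
    have "norm E \<le> real CARD('p) * (real CARD('n) * d)" using that(2) by (rule norm_matrix_le)
    also have "\<dots> < e" using e by (simp add: d_def)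
    finally have "M + E \<in> ball M e" by (simp add: dist_norm)
    then show ?thesis using e(2) that(1) by blast
  qed
  ultimately show ?thesis using that by blast
qed (use that[of 1] in auto)

section \<open>Blockwise action of I \<otimes> M\<close>

definition block :: "'a^('i::finite \<times> 'l::finite) \<Rightarrow> 'i \<Rightarrow> 'a^'l" where
  "block V i = (\<chi> l. V $ (i, l))"

lemma block_eqI: "(\<And>i. block V i = block W i) \<Longrightarrow> V = W"
  by (auto simp: block_def vec_eq_iff)

lemma sum_UNIV_delta_fst:
  fixes g :: "'i::finite \<times> 'l::finite \<Rightarrow> 'a::semiring_1"
  shows "(\<Sum>p\<in>UNIV. (if i = fst p then 1 else 0) * g p) = (\<Sum>l\<in>UNIV. g (i, l))"
proof -
  have "(\<Sum>p\<in>UNIV. (if i = fst p then 1 else 0) * g p)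
      = (\<Sum>j\<in>UNIV. \<Sum>l\<in>UNIV. (if i = j then 1 else 0) * g (j, l))"
    by (simp add: sum.cartesian_product case_prod_unfold flip: UNIV_Times_UNIV)
  also have "\<dots> = (\<Sum>j\<in>UNIV. if i = j then \<Sum>l\<in>UNIV. g (j, l) else 0)"
    by (rule sum.cong) auto
  finally show ?thesis by simp
qed

lemma block_kronecker: "block (kronecker (mat 1) M *v V) i = M *v block V i"
  using sum_UNIV_delta_fst[of i "\<lambda>p. M $ l $ snd p * V $ p" for l]
  by (simp add: vec_eq_iff block_def kronecker_def matrix_vector_mult_def mat_def mult.assoc)

lemma block_kronecker_complex:
  "block (map_matrix complex_of_real (kronecker (mat 1) M) *v V) i = map_matrix complex_of_real M *v block V i"
proof -
  have "complex_of_real (if P then 1 else 0) = (if P then 1 else 0)" for P by simp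
  then show ?thesis
    using sum_UNIV_delta_fst[of i "\<lambda>p. complex_of_real (M $ l $ snd p) * V $ p" for l]
    by (simp add: vec_eq_iff block_def kronecker_def matrix_vector_mult_def mat_def mult.assoc)
qed

lemma block_kronecker_vec: "block (kronecker_vec (mat 1) b *v y) i = y $ i *\<^sub>R b"
proof -
  have "(\<Sum>j\<in>UNIV. (if i = j then 1 else 0) * b $ l * y $ j) = y $ i * b $ l" for l
  proof -
    have "(\<Sum>j\<in>UNIV. (if i = j then 1 else 0) * b $ l * y $ j)
        = (\<Sum>j\<in>UNIV. if i = j then y $ j * b $ l else 0)"
      by (rule sum.cong) auto
    then show ?thesis by simp
  qed
  then show ?thesis
    by (simp add: vec_eq_iff block_def kronecker_vec_def kronecker_def matrix_vector_mult_def mat_def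
        columnvector_def)
qed

lemma block_kronecker_funpow:
  fixes M :: "real^'l^'l"
  shows "block (((*v) (kronecker (mat 1) M) ^^ r) V) i = ((*v) M ^^ r) (block V i)"
proof (induction r)
  case (Suc r)
  have "block (((*v) (kronecker (mat 1) M) ^^ Suc r) V) i
      = M *v block (((*v) (kronecker (mat 1) M) ^^ r) V) i"
    unfolding funpow.simps o_apply by (rule block_kronecker)
  then show ?case using Suc by simp
qed simp

text \<open>A nonzero block of an eigenvector of the large matrix is an eigenvector of
  \<open>M\<close> for the same eigenvalue.\<close>

lemma hurwitz_kronecker:
  assumes "hurwitz M"
  shows "hurwitz (kronecker (mat 1 :: real^'i^'i) M)"
  unfolding hurwitz_def
proof (intro allI impI, elim conjE)
  fix c and V :: "complex^('i \<times> _)"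
  assume V: "V \<noteq> 0" "map_matrix complex_of_real (kronecker (mat 1) M) *v V = c *s V"
  have "\<exists>i. block V i \<noteq> 0"
  proof (rule ccontr)
    assume "\<not> ?thesis"
    then have "V = 0" by (auto simp: block_def vec_eq_iff)
    with V(1) show False by simp
  qed
  then obtain i where "block V i \<noteq> 0" ..
  moreover have "map_matrix complex_of_real M *v block V i = c *s block V i"
    unfolding block_kronecker_complex[symmetric] V(2) by (simp add: block_def vec_eq_iff)
  ultimately show "Re c < 0" using assms unfolding hurwitz_def by blast
qed

text \<open>A nonzero kernel vector would be an eigenvector for 0, whose real part is not
  negative.\<close>

lemma hurwitz_invertible:
  assumes "hurwitz M"
  shows "invertible M"
proof -
  have "v = 0" if "M *v v = 0" for v
  proof (rule ccontr)
    assume "v \<noteq> 0"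
    define cv :: "complex^_" where "cv = (\<chi> i. complex_of_real (v $ i))"
    have "cv \<noteq> 0" using \<open>v \<noteq> 0\<close> by (auto simp: cv_def vec_eq_iff)
    moreover have "map_matrix complex_of_real M *v cv = 0 *s cv"
    proof -
      have "(map_matrix complex_of_real M *v cv) $ i = complex_of_real ((M *v v) $ i)" for i
        by (simp add: cv_def matrix_vector_mult_def)
      then show ?thesis using that by (simp add: vec_eq_iff)
    qed
    ultimately have "Re 0 < 0" using assms unfolding hurwitz_def by blast
    then show False by simp
  qed
  then have "inj ((*v) M)" by (simp add: linear_injective_0)
  then show ?thesis by (simp add: invertible_left_inverse matrix_left_invertible_injective)
qed

section \<open>The jet map and its invertibility\<close>

lemma in_span_image_finite:
  fixes g :: "'i \<Rightarrow> 'a::real_vector"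
  assumes "finite I" "x \<in> span (g ` I)"
  obtains c where "x = (\<Sum>i\<in>I. c i *\<^sub>R g i)"
proof -
  have "\<exists>c. x = (\<Sum>i\<in>I. c i *\<^sub>R g i)"
    using assms
  proof (induction I arbitrary: x rule: finite_induct)
    case (insert a I)
    then obtain k where "x - k *\<^sub>R g a \<in> span (g ` I)" by (auto simp: span_insert)
    then obtain c where c: "x - k *\<^sub>R g a = (\<Sum>i\<in>I. c i *\<^sub>R g i)" using insert.IH by blast
    have "(\<Sum>i\<in>I. (c(a := k)) i *\<^sub>R g i) = (\<Sum>i\<in>I. c i *\<^sub>R g i)"
      using insert.hyps by (intro sum.cong) auto
    then have "x = (\<Sum>i\<in>insert a I. (c(a := k)) i *\<^sub>R g i)"
      using insert.hyps c by (simp add: diff_eq_eq add.commute)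
    then show ?case by blast
  qed simp
  then show ?thesis using that by blast
qed

lemma funpow_inverse_cancel:
  fixes A Ai :: "real^'n^'n"
  assumes "A ** Ai = mat 1"
  shows "((*v) A ^^ (p + q)) (((*v) Ai ^^ q) v) = ((*v) A ^^ p) v"
proof (induction q)
  case (Suc q)
  have "A *v (Ai *v u) = u" for u using assms by (simp add: matrix_vector_mul_assoc)
  moreover have "((*v) A ^^ (p + Suc q)) (((*v) Ai ^^ Suc q) v)
      = ((*v) A ^^ (p + q)) (A *v (Ai *v ((*v) Ai ^^ q) v))"
    by (simp only: add_Suc_right funpow_Suc_right[of "p + q"] funpow.simps(2)[of q] o_apply)
  ultimately show ?case using Suc by simp
qed simp

lemma linear_funpow_matrix: "linear ((*v) A ^^ j)" for A :: "real^'n^'n"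
proof (induction j)
  case (Suc j)
  then show ?case unfolding funpow.simps by (intro linear_compose matrix_vector_mul_linear)
qed (simp add: id_def linear_ident)

text \<open>The matrix \<open>(A\<^sup>-\<^sup>1 B, \<dots>, A\<^sup>-\<^sup>m B)\<close> acting on stacked jets, with the enumeration used by
  \<open>stacked_lie\<close>.\<close>

definition jet_map :: "real^('ny::finite \<times> 'm::finite)^('ny \<times> 'm) \<Rightarrow> real^'ny^('ny \<times> 'm) \<Rightarrow>
    real^('ny \<times> 'm) \<Rightarrow> real^('ny \<times> 'm)" where
  "jet_map Ai B w = (\<Sum>l\<in>UNIV. ((*v) Ai ^^ Suc (to_nat_on (UNIV :: 'm set) l)) (B *v (\<chi> i. w $ (i, l))))"

lemma bij_betw_to_nat_on_UNIV: "bij_betw (to_nat_on (UNIV :: 'm::finite set)) UNIV {..<CARD('m)}"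
  using to_nat_on_finite[of "UNIV :: 'm set"] by simp

text \<open>Passes from the index type to \<open>j < m\<close>. With s = 1/k the right side is the
  sum of (k A)^(-j-1) B y_j, so the weights on the coordinates carry all dependence on k.\<close>

lemma jet_map_scaled:
  fixes Ai :: "real^('ny::finite \<times> 'm::finite)^('ny \<times> 'm)"
  shows "jet_map Ai B (\<chi> q. s ^ Suc (to_nat_on (UNIV :: 'm set) (snd q)) * y (to_nat_on (UNIV :: 'm set) (snd q)) $ fst q)
    = (\<Sum>j<CARD('m). s ^ Suc j *\<^sub>R ((*v) Ai ^^ Suc j) (B *v y j))"
proof -
  have "(\<Sum>j<CARD('m). s ^ Suc j *\<^sub>R ((*v) Ai ^^ Suc j) (B *v y j))
    = (\<Sum>l\<in>UNIV. s ^ Suc (to_nat_on (UNIV :: 'm set) l) *\<^sub>R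
        ((*v) Ai ^^ Suc (to_nat_on (UNIV :: 'm set) l)) (B *v y (to_nat_on (UNIV :: 'm set) l)))"
    by (rule sum.reindex_bij_betw[OF bij_betw_to_nat_on_UNIV, symmetric])
  also have "\<dots> = (\<Sum>l\<in>UNIV. ((*v) Ai ^^ Suc (to_nat_on (UNIV :: 'm set) l))
      (B *v (\<chi> i. s ^ Suc (to_nat_on (UNIV :: 'm set) l) * y (to_nat_on (UNIV :: 'm set) l) $ i)))"
  proof (rule sum.cong[OF refl])
    fix l :: 'm
    let ?j = "to_nat_on (UNIV :: 'm set) l"
    have "(\<chi> i. s ^ Suc ?j * y ?j $ i) = s ^ Suc ?j *\<^sub>R y ?j" by (simp add: vec_eq_iff)
    then show "s ^ Suc ?j *\<^sub>R ((*v) Ai ^^ Suc ?j) (B *v y ?j)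
        = ((*v) Ai ^^ Suc ?j) (B *v (\<chi> i. s ^ Suc ?j * y ?j $ i))"
      by (simp only: linear_cmul[OF matrix_vector_mul_linear] linear_cmul[OF linear_funpow_matrix])
  qed
  finally show ?thesis by (simp add: jet_map_def)
qed

lemma linear_jet_map:
  fixes Ai :: "real^('ny::finite \<times> 'm::finite)^('ny \<times> 'm)"
  shows "linear (jet_map Ai B)"
proof -
  have "linear (\<lambda>w :: real^('ny \<times> 'm). ((*v) Ai ^^ Suc (to_nat_on (UNIV :: 'm set) l)) (B *v (\<chi> i. w $ (i, l))))" for l
  proof -
    have "linear (\<lambda>w :: real^('ny \<times> 'm). (\<chi> i. w $ (i, l)))"
      by (rule linearI) (auto simp: vec_eq_iff)
    from linear_compose[OF linear_compose[OF this matrix_vector_mul_linear[of B]] linear_funpow_matrix]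
    show ?thesis by (simp only: o_def)
  qed
  then show ?thesis unfolding jet_map_def[abs_def] by (intro linear_compose_sum) auto
qed

text \<open>Multiplying by \<open>A\<^sup>m\<close> turns the columns \<open>A\<^sup>-\<^sup>j\<^sup>-\<^sup>1 B\<close> into \<open>A\<^sup>m\<^sup>-\<^sup>1\<^sup>-\<^sup>j B\<close>.\<close>

lemma surj_jet_map:
  fixes M :: "real^'m^'m" and b :: "real^'m"
  defines "A \<equiv> kronecker (mat 1 :: real^'ny^'ny) M" and "B \<equiv> kronecker_vec (mat 1 :: real^'ny^'ny) b"
  assumes M: "controllable M b" and Ai: "A ** Ai = mat 1" "Ai ** A = mat 1"
  shows "surj (jet_map Ai B)"
proof -
  define m where "m = CARD('m)"
  have "\<exists>w. jet_map Ai B w = V" for V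
  proof -
    let ?W = "((*v) A ^^ m) V"
    have "\<exists>c. block ?W i = (\<Sum>r<m. c r *\<^sub>R ((*v) M ^^ r) b)" for i
    proof -
      have "block ?W i \<in> span ((\<lambda>r. ((*v) M ^^ r) b) ` {..<m})"
        using M by (simp add: controllable_def m_def)
      then show ?thesis by (rule in_span_image_finite[OF finite_lessThan]) blast
    qed
    then have "\<exists>c. \<forall>i. block ?W i = (\<Sum>r<m. c i r *\<^sub>R ((*v) M ^^ r) b)"
      by (intro choice allI)
    then obtain c where c: "\<And>i. block ?W i = (\<Sum>r<m. c i r *\<^sub>R ((*v) M ^^ r) b)" by blast
    \<comment> \<open>The reversal pairs each coefficient with its power, as A^m A^(-j-1) B =
      A^(m-1-j) B. The powers of 1 in \<open>w\<close> make it an instance of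
      \<open>jet_map_scaled\<close> with \<open>s = 1\<close>.\<close>
    define y where "y j = (\<chi> i. c i (m - Suc j))" for j
    define w where "w = (\<chi> q. 1 ^ Suc (to_nat_on (UNIV :: 'm set) (snd q)) * y (to_nat_on (UNIV :: 'm set) (snd q)) $ fst q)"
    have "jet_map Ai B w = (\<Sum>j<m. ((*v) Ai ^^ Suc j) (B *v y j))"
      unfolding w_def jet_map_scaled m_def by simp
    then have "((*v) A ^^ m) (jet_map Ai B w) = (\<Sum>j<m. ((*v) A ^^ m) (((*v) Ai ^^ Suc j) (B *v y j)))"
      by (simp only: linear_sum[OF linear_funpow_matrix])
    also have "\<dots> = (\<Sum>j<m. ((*v) A ^^ (m - Suc j)) (B *v y j))"
    proof (rule sum.cong[OF refl])
      fix j assume "j \<in> {..<m}"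
      then have "m = (m - Suc j) + Suc j" by simp
      then show "((*v) A ^^ m) (((*v) Ai ^^ Suc j) (B *v y j)) = ((*v) A ^^ (m - Suc j)) (B *v y j)"
        using funpow_inverse_cancel[OF Ai(1), of "m - Suc j" "Suc j"] by metis
    qed
    also have "\<dots> = ?W"
    proof (rule block_eqI)
      fix i
      have block_sum: "block (\<Sum>j<m. x j) i = (\<Sum>j<m. block (x j) i)" for x :: "nat \<Rightarrow> real^('ny \<times> 'm)"
        by (simp add: block_def vec_eq_iff)
      have "block (\<Sum>j<m. ((*v) A ^^ (m - Suc j)) (B *v y j)) i
          = (\<Sum>j<m. c i (m - Suc j) *\<^sub>R ((*v) M ^^ (m - Suc j)) b)"
        by (simp add: block_sum A_def B_def block_kronecker_funpow block_kronecker_vec y_def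
            linear_cmul[OF linear_funpow_matrix])
      also have "\<dots> = (\<Sum>r<m. c i r *\<^sub>R ((*v) M ^^ r) b)" by (rule sum.nat_diff_reindex)
      finally show "block (\<Sum>j<m. ((*v) A ^^ (m - Suc j)) (B *v y j)) i = block ?W i" by (simp add: c)
    qed
    finally have "((*v) Ai ^^ (0 + m)) (((*v) A ^^ m) (jet_map Ai B w)) = ((*v) Ai ^^ (0 + m)) ?W" by simp
    then have "jet_map Ai B w = V"
      unfolding funpow_inverse_cancel[OF Ai(2)] by simp
    then show ?thesis by blast
  qed
  then show ?thesis by (metis surjI)
qed

section \<open>Solutions for large gain\<close>

lemma (in equivalent_norm) C11_of_norm:
  assumes "C11 norm L M u D"
  shows "C11 N (\<bar>c\<bar> * L) (\<bar>c\<bar> * M) u D"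
proof -
  have le: "N v \<le> \<bar>c\<bar> * norm v" for v
    using N_upper[of v] mult_right_mono[OF abs_ge_self[of c] norm_ge_zero[of v]] by linarith
  have "N v \<le> \<bar>c\<bar> * t" if "norm v \<le> t" for v t
    using le[of v] mult_left_mono[OF that, of "\<bar>c\<bar>"] by simp
  then show ?thesis using assms by (simp add: C11_def mult.assoc)
qed

lemma C11_imp_C_k_1:
  fixes u :: "'a::real_normed_vector \<Rightarrow> 'b::real_normed_vector"
  assumes u: "C11 norm L M u D"
  shows "C_k 1 u"
proof -
  have "continuous_on UNIV (\<lambda>x. D x v)" for v
  proof (rule continuous_onI)
    fix x :: 'a and e :: real
    assume "e > 0"
    define c where "c = \<bar>6 * M * norm v\<bar> + 1"
    have "dist (D y v) (D x v) \<le> e" if "dist y x < e / c" for y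
    proof -
      have "norm (D y v - D x v) \<le> 6 * M * norm v * norm (y - x)"
        using C11_derivative_lipschitz[OF u, of y v x] by (simp add: mult_ac)
      also have "\<dots> \<le> c * norm (y - x)" by (intro mult_right_mono) (auto simp: c_def)
      also have "\<dots> \<le> c * (e / c)" using that by (intro mult_left_mono) (auto simp: dist_norm c_def)
      also have "\<dots> = e" by (simp add: c_def add_nonneg_eq_0_iff)
      finally show ?thesis by (simp add: dist_norm)
    qed
    moreover have "e / c > 0" using \<open>e > 0\<close> by (simp add: c_def add_nonneg_pos)
    ultimately show "\<exists>d>0. \<forall>x'\<in>UNIV. dist x' x < d \<longrightarrow> dist (D x' v) (D x v) \<le> e" by blast
  qed
  then have "C_k (Suc 0) u"
    using C11_has_derivative[OF u] by (intro C_k_SucI[where F' = "\<lambda>x. blinfun_apply (D x)"]) auto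
  then show ?thesis by simp
qed

text \<open>Replacing A by k A multiplies the rate by k. Once k a > 2 Lf, with \<open>Lf\<close> a
  Lipschitz constant of the extended field, k a - Lf is at least k a / 2, and the derivative bound
  for \<open>S\<close> becomes O(1/k).\<close>

lemma transport_solution_large_gain:
  fixes f :: "real^'n \<Rightarrow> real^'n" and g :: "real^'n \<Rightarrow> real^'p"
  assumes f: "smooth f" and g: "smooth g" and X: "compact X" and A: "hurwitz A"
  obtains k0 C where "k0 > 0" "C \<ge> 0"
    "\<forall>k>k0. \<exists>L M S D. C11 norm L M S D \<and> (\<forall>x w. norm (D x w) \<le> C / k * norm w) \<and>
      (\<forall>x\<in>X. D x (f x) = k *\<^sub>R (A *v S x) + g x)"
proof -
  obtain N c e0 a where norm: "equivalent_norm N c" and e0: "e0 > 0" and a: "a > 0"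
    and N: "\<And>e v. 0 < e \<Longrightarrow> e \<le> e0 \<Longrightarrow> N (v + e *\<^sub>R (A *v v)) \<le> (1 - e * a) * N v"
    using hurwitz_adapted_norm[OF A] by metis
  interpret equivalent_norm N c by (rule norm)
  obtain F F' Lf Mf Bf where F: "C11 norm Lf Mf F F'" "Lf \<ge> 0" "Mf \<ge> 0" "\<And>x. x \<in> X \<Longrightarrow> F x = f x"
    using smooth_C11_extension[OF f X] by metis
  obtain G G' Lg Mg Bg where G: "C11 norm Lg Mg G G'" "Lg \<ge> 0" "Mg \<ge> 0" "\<And>x. x \<in> X \<Longrightarrow> G x = g x"
      "\<And>x. norm (G x) \<le> Bg"
    using smooth_C11_extension[OF g X] by metis
  have G_bound: "N (G x) \<le> \<bar>c\<bar> * Bg" for x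
  proof -
    have "N (G x) \<le> \<bar>c\<bar> * norm (G x)"
      using N_upper[of "G x"] mult_right_mono[OF abs_ge_self[of c] norm_ge_zero[of "G x"]] by linarith
    also have "\<dots> \<le> \<bar>c\<bar> * Bg" using G(5) by (intro mult_left_mono) auto
    finally show ?thesis .
  qed
  \<comment> \<open>The first summand encodes k a > 2 Lf; the 1 keeps \<open>k0\<close> positive
    even if \<open>Lf\<close> is 0.\<close>
  define k0 where "k0 = 2 * Lf / a + 1"
  define C where "C = 2 * (\<bar>c\<bar> * Lg) / a"
  have "k0 > 0" using F(2) a by (simp add: k0_def add_nonneg_pos)
  moreover have "C \<ge> 0" using G(2) a by (simp add: C_def)
  moreover have "\<exists>L M S D. C11 norm L M S D \<and> (\<forall>x w. norm (D x w) \<le> C / k * norm w) \<and>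
      (\<forall>x\<in>X. D x (f x) = k *\<^sub>R (A *v S x) + g x)" if k: "k > k0" for k
  proof -
    have "k > 0" using k \<open>k0 > 0\<close> by linarith
    have gap: "k * a > 2 * Lf"
    proof -
      have "2 * Lf / a < k" using k by (simp add: k0_def)
      then show ?thesis using a by (simp add: pos_divide_less_eq)
    qed
    define P where "P = Blinfun (\<lambda>v. k *\<^sub>R (A *v v))"
    have P: "blinfun_apply P v = k *\<^sub>R (A *v v)" for v
      unfolding P_def
      by (rule bounded_linear_Blinfun_apply[THEN fun_cong])
        (intro bounded_linear_scaleR_right[THEN bounded_linear_compose] matrix_vector_mul_bounded_linear)
    \<comment> \<open>A step \<open>e\<close> for k A is the step \<open>e * k\<close> for
      \<open>A\<close>, hence the range up to \<open>e0 / k\<close> and the rate k a.\<close>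
    have step: "N (v + e *\<^sub>R P v) \<le> (1 - e * (k * a)) * N v" if "0 < e" "e \<le> e0 / k" for e v
      using N[of "e * k" v] that \<open>k > 0\<close> by (simp add: P pos_le_divide_eq mult.assoc)
    have "e0 / k > 0" using e0 \<open>k > 0\<close> by simp
    have "0 \<le> \<bar>c\<bar> * Lg" "0 \<le> \<bar>c\<bar> * Mg" using G by auto
    then obtain S D M where S: "C11 norm (\<bar>c\<bar> * Lg / (k * a - Lf)) M S D"
      "\<And>x. D x (F x) = P (S x) + G x"
      using transport_solution[OF norm step \<open>e0 / k > 0\<close> F(1-3) gap C11_of_norm[OF G(1)] _ _ G_bound]
      by metis
    have "\<bar>c\<bar> * Lg / (k * a - Lf) \<le> C / k"
    proof -
      have "k * a / 2 \<le> k * a - Lf" "0 < k * a - Lf" "0 < k * a / 2" using gap F(2) by linarith+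
      then have "\<bar>c\<bar> * Lg / (k * a - Lf) \<le> \<bar>c\<bar> * Lg / (k * a / 2)"
        using G(2) by (intro divide_left_mono mult_pos_pos) auto
      then show ?thesis by (simp add: C_def mult_ac)
    qed
    then have "norm (D x w) \<le> C / k * norm w" for x w
      using S(1) unfolding C11_def by (meson mult_right_mono norm_ge_zero order_trans)
    moreover have "D x (f x) = k *\<^sub>R (A *v S x) + g x" if "x \<in> X" for x
      using S(2)[of x] F(4)[OF that] G(4)[OF that] by (simp add: P)
    ultimately show ?thesis using S(1) by blast
  qed
  ultimately show ?thesis using that by blast
qed

section \<open>Smoothness and Jacobian of the stacked map\<close>

lemma smooth_vec:
  fixes F :: "'a::real_normed_vector \<Rightarrow> real^'p"
  assumes "\<And>q. smooth (\<lambda>x. F x $ q)"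
  shows "smooth F"
proof -
  have "smooth (\<lambda>x. \<Sum>q\<in>UNIV. (F x $ q) *\<^sub>R axis q (1::real))"
    by (intro smooth_sum smooth_linear[OF bounded_linear_scaleR_left] assms)
  moreover have "(\<Sum>q\<in>UNIV. (F x $ q) *\<^sub>R axis q 1) = F x" for x
    using basis_expansion[of "F x"] by (simp add: scalar_mult_eq_scaleR)
  ultimately show ?thesis by simp
qed

lemma smooth_stacked_lie:
  assumes "smooth f" "smooth h"
  shows "smooth (stacked_lie f h :: real^'n \<Rightarrow> real^('p::finite \<times> 'm::finite))"
proof (rule smooth_vec)
  fix q :: "'p \<times> 'm"
  show "smooth (\<lambda>x. (stacked_lie f h x :: real^('p \<times> 'm)) $ q)"
    unfolding stacked_lie_def vec_lambda_beta
    by (rule smooth_linear[OF bounded_linear_vec_nth smooth_lie_derivative[OF assms]])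
qed

lemma continuous_on_jacobian:
  fixes F :: "real^'n \<Rightarrow> real^'p"
  assumes "smooth F"
  shows "continuous_on UNIV (\<lambda>x. jacobian F (at x))"
proof -
  have "continuous_on UNIV (\<lambda>x. frechet_derivative F (at x) (axis j 1) $ i)" for i j
    by (intro bounded_linear.continuous_on[OF bounded_linear_vec_nth] smooth_continuous_on
        smooth_frechet_derivative assms)
  then show ?thesis
    unfolding jacobian_def matrix_def by (intro continuous_on_vec_lambda)
qed

lemma jacobian_stacked_lie:
  fixes h :: "real^'n \<Rightarrow> real^'p::finite"
  assumes "smooth f" "smooth h"
  shows "(jacobian (stacked_lie f h :: real^'n \<Rightarrow> real^('p::finite \<times> 'm::finite)) (at x) *v w) $ q
    = (jacobian (lie_derivative f (to_nat_on (UNIV :: 'm set) (snd q)) h) (at x) *v w) $ fst q"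
proof -
  let ?H = "stacked_lie f h :: real^'n \<Rightarrow> real^('p \<times> 'm)"
  let ?L = "lie_derivative f (to_nat_on (UNIV :: 'm set) (snd q)) h"
  have "((\<lambda>x. ?H x $ q) has_derivative (\<lambda>w. (jacobian ?H (at x) *v w) $ q)) (at x)"
    by (rule bounded_linear.has_derivative[OF bounded_linear_vec_nth smooth_jacobian[OF smooth_stacked_lie[OF assms]]])
  moreover have "((\<lambda>x. ?L x $ fst q) has_derivative (\<lambda>w. (jacobian ?L (at x) *v w) $ fst q)) (at x)"
    by (rule bounded_linear.has_derivative[OF bounded_linear_vec_nth smooth_jacobian[OF smooth_lie_derivative[OF assms]]])
  moreover have "(\<lambda>x. ?H x $ q) = (\<lambda>x. ?L x $ fst q)" by (simp add: stacked_lie_def)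
  ultimately show ?thesis by (metis has_derivative_unique)
qed

lemma bij_comp_inj_or_surj:
  assumes "bij P"
  shows "inj (\<lambda>x. P (g x)) \<or> surj (\<lambda>x. P (g x)) \<longleftrightarrow> inj g \<or> surj g"
proof -
  have "inj (\<lambda>x. P (g x)) \<longleftrightarrow> inj g"
    using inj_eq[OF bij_is_inj[OF assms]] by (simp add: inj_def)
  moreover have "surj (\<lambda>x. P (g x)) \<longleftrightarrow> surj g"
    using inj_image_eq_iff[OF bij_is_inj[OF assms], of "range g" UNIV] bij_is_surj[OF assms]
    by (simp add: image_image)
  ultimately show ?thesis by simp
qed


text \<open>The smallest weight is s^m, carried by the highest Lie derivative. It is matched by the
  factor k^(-m) in front of \<open>S\<close>.\<close>

lemma norm_le_jet_rescale:
  fixes w :: "real^('p::finite \<times> 'm::finite)"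
  assumes s: "0 \<le> s" "s \<le> 1"
  shows "s ^ CARD('m) * norm w \<le> norm (\<chi> q. s ^ Suc (to_nat_on (UNIV :: 'm set) (snd q)) * w $ q)"
proof -
  have "norm (s ^ CARD('m) *\<^sub>R w) \<le> norm (\<chi> q. s ^ Suc (to_nat_on (UNIV :: 'm set) (snd q)) * w $ q)"
  proof (rule norm_le_componentwise_cart)
    fix q :: "'p \<times> 'm"
    have "to_nat_on (UNIV :: 'm set) (snd q) < CARD('m)"
      using bij_betw_to_nat_on_UNIV[where 'm = 'm] by (auto simp: bij_betw_def)
    then have "s ^ CARD('m) \<le> s ^ Suc (to_nat_on (UNIV :: 'm set) (snd q))"
      using s by (intro power_decreasing) auto
    then have "s ^ CARD('m) * \<bar>w $ q\<bar> \<le> s ^ Suc (to_nat_on (UNIV :: 'm set) (snd q)) * \<bar>w $ q\<bar>"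
      by (rule mult_right_mono) simp
    then show "norm ((s ^ CARD('m) *\<^sub>R w) $ q)
        \<le> norm ((\<chi> q. s ^ Suc (to_nat_on (UNIV :: 'm set) (snd q)) * w $ q) $ q)"
      using s by (simp add: abs_mult)
  qed
  then show ?thesis using s by simp
qed

theorem proposition3:
  fixes f :: "real^'nx \<Rightarrow> real^'nx"
    and h :: "real^'nx \<Rightarrow> real^'ny"
    and X :: "(real^'nx) set"
    and A\<^sub>o :: "real^'m^'m"
    and B\<^sub>o :: "real^'m"
    and A :: "real^('ny \<times> 'm)^('ny \<times> 'm)"
    and B :: "real^'ny^('ny \<times> 'm)"
  assumes "smooth f" and "smooth h"
    and "compact X"
    and "full_rank_on X (stacked_lie f h :: real^'nx \<Rightarrow> real^('ny \<times> 'm))"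
    and "controllable A\<^sub>o B\<^sub>o"
    and "hurwitz A\<^sub>o"
  defines "A \<equiv> kronecker (mat 1) A\<^sub>o"
    and "B \<equiv> kronecker_vec (mat 1) B\<^sub>o"
  shows "\<exists>kstar>0. \<forall>k::real. k > kstar \<longrightarrow>
           (\<exists>T :: real^'nx \<Rightarrow> real^('ny \<times> 'm).
              C_k 1 T \<and> full_rank_on X T \<and>
              (\<forall>x\<in>X. jacobian T (at x) *v f x = k *\<^sub>R (A *v T x) + B *v h x))"
proof -
  let ?H = "stacked_lie f h :: real^'nx \<Rightarrow> real^('ny \<times> 'm)"
  let ?idx = "to_nat_on (UNIV :: 'm set)"
  let ?DH = "\<lambda>x. jacobian ?H (at x)"
  define m where "m = CARD('m)"
  have A: "hurwitz A" unfolding A_def by (rule hurwitz_kronecker[OF assms(6)])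
  obtain Ai where Ai: "A ** Ai = mat 1" "Ai ** A = mat 1"
    using hurwitz_invertible[OF A] unfolding invertible_def by blast
  define g where "g x = ((*v) Ai ^^ m) (B *v lie_derivative f m h x)" for x
  have "bounded_linear (\<lambda>y. ((*v) Ai ^^ m) (B *v y))"
    using linear_compose[OF matrix_vector_mul_linear[of B] linear_funpow_matrix[where A = Ai and j = m]]
    by (simp add: linear_linear o_def)
  then have g: "smooth g"
    unfolding g_def[abs_def] by (rule smooth_linear[OF _ smooth_lie_derivative[OF assms(1,2)]])
  obtain k0 C where k0: "k0 > 0" and C: "C \<ge> 0" and sol: "\<forall>k>k0. \<exists>L M S D. C11 norm L M S D \<and> (\<forall>x w. norm (D x w) \<le> C / k * norm w) \<and>
      (\<forall>x\<in>X. D x (f x) = k *\<^sub>R (A *v S x) + g x)"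
    by (rule transport_solution_large_gain[OF assms(1) g assms(3) A])
  define J where "J = jet_map Ai B"
  have J_linear: "linear J" unfolding J_def by (rule linear_jet_map)
  have "surj J" unfolding J_def B_def
    by (rule surj_jet_map[OF assms(5)]) (use Ai in \<open>auto simp: A_def\<close>)
  then have "inj J" by (rule linear_surjective_imp_injective[OF J_linear]) simp
  then obtain c where c: "c > 0" "\<And>w. c * norm w \<le> norm (J w)"
    using linear_inj_bounded_below_pos[OF J_linear] by metis
  have "compact (?DH ` X)"
    using continuous_on_jacobian[OF smooth_stacked_lie[OF assms(1,2)]] assms(3) continuous_on_subset
    by (intro compact_continuous_image) auto
  moreover have "rank M = min CARD('ny \<times> 'm) CARD('nx)" if "M \<in> ?DH ` X" for M
    using that assms(4) unfolding full_rank_on_def by blast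
  \<comment> \<open>Compactness gives one margin \<open>d\<close> for all points of
    \<open>X\<close>, fixed before k is chosen.\<close>
  ultimately obtain d where d: "d > 0" "\<forall>M\<in>?DH ` X. \<forall>E. (\<forall>w. norm (E *v w) \<le> d * norm w) \<longrightarrow>
      rank (M + E) = min CARD('ny \<times> 'm) CARD('nx)"
    by (rule full_rank_perturbation)
  \<comment> \<open>\<open>k0\<close> provides \<open>S\<close>, 1 ensures s \<le> 1 for the
    rescaling bound, and the last entry makes C / k at most c d, where \<open>c\<close> accounts for
    inverting \<open>J\<close> and \<open>d\<close> is the tolerated perturbation.\<close>
  define kstar where "kstar = max (max k0 1) (C / (c * d))"
  have "\<exists>T :: real^'nx \<Rightarrow> real^('ny \<times> 'm).
      C_k 1 T \<and> full_rank_on X T \<and>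
      (\<forall>x\<in>X. jacobian T (at x) *v f x = k *\<^sub>R (A *v T x) + B *v h x)" if "k > kstar" for k
  proof -
    have k: "k > k0" "k > 1" "k > C / (c * d)" using that by (auto simp: kstar_def)
    obtain L M S D where S: "C11 norm L M S D" "\<And>x w. norm (D x w) \<le> C / k * norm w"
      "\<And>x. x \<in> X \<Longrightarrow> D x (f x) = k *\<^sub>R (A *v S x) + g x"
      using sol[rule_format, OF k(1)] by blast
    define s where "s = 1 / k"
    have s: "0 < s" "s \<le> 1" "k * s = 1" using k by (auto simp: s_def)
    define R :: "real^('ny \<times> 'm) \<Rightarrow> real^('ny \<times> 'm)" where
      "R w = (\<chi> q. s ^ Suc (?idx (snd q)) * w $ q)" for w
    have R_linear: "linear R" by (rule linearI) (auto simp: R_def vec_eq_iff algebra_simps)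
    define P where "P w = - J (R w)" for w
    have P_linear: "linear P"
      using linear_compose_neg[OF linear_compose[OF R_linear J_linear]] by (simp add: P_def[abs_def] o_def)
    have P_lower: "c * s ^ m * norm w \<le> norm (P w)" for w
    proof -
      have "c * (s ^ m * norm w) \<le> c * norm (R w)"
        using norm_le_jet_rescale[of s w] s c(1) by (simp add: m_def R_def)
      also have "\<dots> \<le> norm (P w)" using c(2)[of "R w"] by (simp add: P_def)
      finally show ?thesis by (simp add: mult.assoc)
    qed
    have "inj P"
    proof -
      have "w = 0" if "P w = 0" for w
      proof -
        have "c * s ^ m * norm w \<le> c * s ^ m * 0" using P_lower[of w] that by simp
        moreover have "c * s ^ m > 0" using c s by simp
        ultimately have "norm w \<le> 0" by (rule mult_left_le_imp_le)
        then show ?thesis by simp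
      qed
      then show ?thesis using linear_injective_0[OF P_linear] by blast
    qed
    then have "surj P" by (rule linear_injective_imp_surjective[OF P_linear]) simp
    then obtain Q where Q: "linear Q" "P \<circ> Q = id"
      using linear_surjective_right_inverse[OF P_linear] by blast
    have PQ: "P (Q v) = v" for v using fun_cong[OF Q(2), of v] by simp
    define T where "T x = P (?H x) + s ^ m *\<^sub>R S x" for x
    have P_bl: "bounded_linear P" using P_linear by (simp add: linear_linear)
    have H: "smooth ?H" by (rule smooth_stacked_lie[OF assms(1,2)])
    then have "C_k 1 ?H" unfolding smooth_def ..
    then have "C_k 1 (\<lambda>x. P (?H x))" by (rule C_k_linear[OF P_bl])
    then have "C_k 1 T"
      unfolding T_def[abs_def]
      by (rule C_k_add[OF _ C_k_linear[OF bounded_linear_scaleR_right C11_imp_C_k_1[OF S(1)]]])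
    moreover have DT: "jacobian T (at x) *v w = P (?DH x *v w) + s ^ m *\<^sub>R D x w" for x w
    proof -
      have der: "(T has_derivative (\<lambda>w. P (?DH x *v w) + s ^ m *\<^sub>R D x w)) (at x)"
        unfolding T_def[abs_def]
        by (rule has_derivative_add[OF bounded_linear.has_derivative[OF P_bl smooth_jacobian[OF H]]
              has_derivative_scaleR_right[OF C11_has_derivative[OF S(1)]]])
      then have "(T has_derivative (\<lambda>w. jacobian T (at x) *v w)) (at x)"
        unfolding jacobian_works[symmetric] by (rule differentiableI)
      from has_derivative_unique[OF this der] show ?thesis by (rule fun_cong)
    qed
    have "full_rank_on X T"
      unfolding full_rank_on_def
    proof
      fix x assume x: "x \<in> X"
      \<comment> \<open>Pulling the derivative of s^m S back through \<open>P\<close> writes the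
        Jacobian of \<open>T\<close> as \<open>P\<close> after \<open>?DH x + E\<close>; the factor
        s^m cancels against the lower bound for \<open>P\<close>.\<close>
      define E where "E = matrix (\<lambda>w. Q (s ^ m *\<^sub>R D x w))"
      have "linear (\<lambda>w. s ^ m *\<^sub>R blinfun_apply (D x) w)"
        by (intro linear_compose_scale_right bounded_linear.linear blinfun.bounded_linear_right)
      from linear_compose[OF this Q(1)] have E: "E *v w = Q (s ^ m *\<^sub>R D x w)" for w
        unfolding E_def by (simp add: o_def matrix_works)
      have "norm (E *v w) \<le> d * norm w" for w
      proof -
        have "c * s ^ m * norm (E *v w) \<le> norm (P (E *v w))" by (rule P_lower)
        also have "\<dots> = s ^ m * norm (D x w)" using s by (simp add: E PQ)
        finally have "s ^ m * (c * norm (E *v w)) \<le> s ^ m * norm (D x w)" by (simp add: mult_ac)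
        then have "c * norm (E *v w) \<le> norm (D x w)" using s by simp
        also have "\<dots> \<le> C / k * norm w" by (rule S(2))
        also have "\<dots> \<le> c * d * norm w"
        proof (rule mult_right_mono)
          show "C / k \<le> c * d" using k c d by (simp add: field_simps)
        qed simp
        finally show ?thesis using c(1) by (simp add: mult.assoc)
      qed
      then have "rank (?DH x + E) = min CARD('ny \<times> 'm) CARD('nx)" using d(2) x by blast
      then have "inj ((*v) (?DH x + E)) \<or> surj ((*v) (?DH x + E))" by (simp only: full_rank_iff)
      moreover have "jacobian T (at x) *v w = P ((?DH x + E) *v w)" for w
        by (simp add: DT E PQ matrix_vector_mult_add_rdistrib linear_add[OF P_linear])
      moreover have "bij P" using \<open>inj P\<close> \<open>surj P\<close> by (simp add: bij_def)
      ultimately have "inj ((*v) (jacobian T (at x))) \<or> surj ((*v) (jacobian T (at x)))"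
        using bij_comp_inj_or_surj[of P "(*v) (?DH x + E)"] by presburger
      then show "rank (jacobian T (at x)) = min CARD('ny \<times> 'm) CARD('nx)" by (simp only: full_rank_iff)
    qed
    moreover have "jacobian T (at x) *v f x = k *\<^sub>R (A *v T x) + B *v h x" if x: "x \<in> X" for x
    proof -
      \<comment> \<open>Both sides are sums of such terms: differentiating along \<open>f\<close>
        raises the Lie order and gives a (j + 1), while k A removes one inverse and gives a
        j.\<close>
      define a where "a j = s ^ j *\<^sub>R ((*v) Ai ^^ j) (B *v lie_derivative f j h x)" for j
      let ?b = "\<lambda>j. s ^ Suc j *\<^sub>R ((*v) Ai ^^ Suc j) (B *v lie_derivative f j h x)"
      have PH: "P (?H x) = - (\<Sum>j<m. ?b j)"
        using jet_map_scaled[of Ai B s "\<lambda>j. lie_derivative f j h x"]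
        by (simp add: P_def J_def R_def stacked_lie_def m_def)
      have "(?DH x *v f x) $ q = lie_derivative f (Suc (?idx (snd q))) h x $ fst q" for q
        by (simp add: jacobian_stacked_lie[OF assms(1,2)])
      then have DH: "P (?DH x *v f x) = - (\<Sum>j<m. a (Suc j))"
        using jet_map_scaled[of Ai B s "\<lambda>j. lie_derivative f (Suc j) h x"]
        by (simp add: P_def J_def R_def a_def m_def)
      have b: "k *\<^sub>R (A *v ?b j) = a j" for j
      proof -
        have "A *v ((*v) Ai ^^ Suc j) u = ((*v) Ai ^^ j) u" for u
          using Ai(1) by (simp add: matrix_vector_mul_assoc)
        then have "k *\<^sub>R (A *v ?b j) = (k * s ^ Suc j) *\<^sub>R ((*v) Ai ^^ j) (B *v lie_derivative f j h x)"
          by (simp only: linear_cmul[OF matrix_vector_mul_linear] scaleR_scaleR)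
        moreover have "k * s ^ Suc j = s ^ j" using s(3) by (simp add: mult.assoc[symmetric])
        ultimately show ?thesis by (simp only: a_def)
      qed
      have "k *\<^sub>R (A *v P (?H x)) = - (\<Sum>j<m. k *\<^sub>R (A *v ?b j))"
        unfolding PH by (simp only: linear_neg[OF matrix_vector_mul_linear] scaleR_minus_right
            linear_sum[OF matrix_vector_mul_linear] scaleR_sum_right)
      then have AH: "k *\<^sub>R (A *v P (?H x)) = - (\<Sum>j<m. a j)" by (simp only: b)
      have "(\<Sum>j<m. a (Suc j)) - (\<Sum>j<m. a j) = a m - a 0"
        using sum_lessThan_telescope[of a m] by (simp add: sum_subtractf)
      moreover have "a 0 = B *v h x" by (simp add: a_def)
      moreover have "a m = s ^ m *\<^sub>R g x" by (simp add: a_def g_def)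
      \<comment> \<open>Only the ends of the telescope survive: the term B h of the equation and the
        remainder s^m g, which is absorbed by the source in the equation for
        \<open>S\<close>.\<close>
      ultimately have tel: "- (\<Sum>j<m. a (Suc j)) + s ^ m *\<^sub>R g x = - (\<Sum>j<m. a j) + B *v h x"
        by (simp add: algebra_simps)
      have "jacobian T (at x) *v f x
          = - (\<Sum>j<m. a (Suc j)) + s ^ m *\<^sub>R g x + s ^ m *\<^sub>R k *\<^sub>R (A *v S x)"
        by (simp only: DT DH S(3)[OF x] scaleR_add_right add.assoc add.commute[of "s ^ m *\<^sub>R g x"])
      also have "\<dots> = - (\<Sum>j<m. a j) + s ^ m *\<^sub>R k *\<^sub>R (A *v S x) + B *v h x"
        unfolding tel by simp
      also have "- (\<Sum>j<m. a j) + s ^ m *\<^sub>R k *\<^sub>R (A *v S x) = k *\<^sub>R (A *v T x)"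
        unfolding AH[symmetric] T_def
        by (simp only: linear_add[OF matrix_vector_mul_linear] linear_cmul[OF matrix_vector_mul_linear]
            scaleR_add_right scaleR_left_commute)
      finally show ?thesis .
    qed
    ultimately show ?thesis by blast
  qed
  moreover have "kstar > 0" by (simp add: kstar_def)
  ultimately show ?thesis by blast
qed

end
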